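(* For every integer $m\geq 3$ there is a finite connected graph $G$ with $\operatorname{rl_s}(G)=m$ and $\operatorname{rl_p}(G)=2^{m-1}$.
   Context: Graphs are simple and undirected; $d(\cdot,\cdot)$ denotes graph distance. The $k$-probe Robber Locating game on a graph $G$ (known to both players): a robber occupies a vertex of $G$, initially arbitrary and unknown to the cop. Cop and robber alternate turns, the cop first. At her turn the cop chooses a list $u_1,\ldots,u_k$ of vertices (all specified before any answer is received) and is then told the distances $d(v,u_1),\ldots,d(v,u_k)$, where $v$ is the robber's current location. If from this and all previous information she can deduce $v$, she wins. At his turn the robber may stay where he is or move to an adjacent vertex. $G$ is $k$-locatable if the cop has a deterministic strategy (each list of probes may depend on previous answers) which wins after finitely many turns against every possible starting vertex and sequence of moves of the robber. $G$ is locatable if it is $1$-locatable. For a positive integer $m$, $G^{1/m}$ is the graph obtained from $G$ by replacing each edge by a path of length $m$ (with $m-1$ new internal vertices for each edge). $\operatorname{rl_p}(G)$ is the minimum $k$ such that $G$ is $k$-locatable; $\operatorname{rl_s}(G)$ is the smallest positive integer $s$ such that $G^{1/m}$ is locatable for all integers $m\geq s$. *)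

theory Defs
  imports "Graph_Theory.Graph_Theory" "HOL-Library.Extended_Nat"
begin

text \<open>
  A finite simple undirected graph is a \<open>pair_graph\<close> (finite, loop-free, symmetric set of arcs).
\<close>

definition graph_dist :: "'a pair_pre_digraph \<Rightarrow> 'a \<Rightarrow> 'a \<Rightarrow> ereal" where
  "graph_dist G u v = wf_digraph.\<mu> (with_proj G) (\<lambda>_. 1) u v"


section \<open>The Robber Locating game\<close>

text \<open>
  A strategy maps the list of answers received so far (oldest first, one list of distances per
  turn) to the next list of probes. The cop's own earlier probes are determined by these answers.
\<close>

type_synonym 'a strategy = "ereal list list \<Rightarrow> 'a list"

definition probe_strategy :: "nat \<Rightarrow> 'a pair_pre_digraph \<Rightarrow> 'a strategy \<Rightarrow> bool" where
  "probe_strategy k G \<sigma> \<longleftrightarrow> (\<forall>h. length (\<sigma> h) = k \<and> set (\<sigma> h) \<subseteq> pverts G)"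

text \<open>\<open>w n\<close> is the robber's position when the cop makes her probes of turn \<open>n\<close>, counting from 0.\<close>

definition robber_walk :: "'a pair_pre_digraph \<Rightarrow> (nat \<Rightarrow> 'a) \<Rightarrow> bool" where
  "robber_walk G w \<longleftrightarrow>
     w 0 \<in> pverts G \<and> (\<forall>n. w (Suc n) = w n \<or> (w n, w (Suc n)) \<in> parcs G)"

text \<open>\<open>answers G \<sigma> w n\<close> lists the answers to the first \<open>n\<close> turns.\<close>

primrec answers ::
    "'a pair_pre_digraph \<Rightarrow> 'a strategy \<Rightarrow> (nat \<Rightarrow> 'a) \<Rightarrow> nat \<Rightarrow> ereal list list" where
  "answers G \<sigma> w 0 = []"
| "answers G \<sigma> w (Suc n) =
     answers G \<sigma> w n @ [map (\<lambda>u. graph_dist G (w n) u) (\<sigma> (answers G \<sigma> w n))]"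

text \<open>
  The cop can deduce the robber's position right after the answers of turn \<open>n\<close> if all robber
  trajectories that give the same answers are at the same vertex at that time.
\<close>

definition located_at ::
    "'a pair_pre_digraph \<Rightarrow> 'a strategy \<Rightarrow> (nat \<Rightarrow> 'a) \<Rightarrow> nat \<Rightarrow> bool" where
  "located_at G \<sigma> w n \<longleftrightarrow>
     (\<forall>w'. robber_walk G w' \<and> answers G \<sigma> w' (Suc n) = answers G \<sigma> w (Suc n) \<longrightarrow> w' n = w n)"

definition k_locatable :: "nat \<Rightarrow> 'a pair_pre_digraph \<Rightarrow> bool" where
  "k_locatable k G \<longleftrightarrow>
     (\<exists>\<sigma>. probe_strategy k G \<sigma> \<and> (\<forall>w. robber_walk G w \<longrightarrow> (\<exists>n. located_at G \<sigma> w n)))"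

abbreviation locatable :: "'a pair_pre_digraph \<Rightarrow> bool" where
  "locatable G \<equiv> k_locatable 1 G"


section \<open>Equal subdivisions\<close>

text \<open>
  An edge joining \<open>u < v\<close> is replaced by the path
  \<open>Branch u, Inner u v 1, \<dots>, Inner u v (m - 1), Branch v\<close>. The linear order serves only to name
  each internal vertex once. \<open>path_vertex m u v i\<close> is the vertex of this path at position \<open>i \<le> m\<close>.
\<close>

datatype 'a sub_vertex = Branch 'a | Inner 'a 'a nat

definition path_vertex :: "nat \<Rightarrow> 'a \<Rightarrow> 'a \<Rightarrow> nat \<Rightarrow> 'a sub_vertex" where
  "path_vertex m u v i = (if i = 0 then Branch u else if i = m then Branch v else Inner u v i)"

definition edge_subdivision ::
    "nat \<Rightarrow> 'a::linorder pair_pre_digraph \<Rightarrow> 'a sub_vertex pair_pre_digraph" where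
  "edge_subdivision m G =
     \<lparr> pverts = Branch ` pverts G
         \<union> {Inner u v i |u v i. (u, v) \<in> parcs G \<and> u < v \<and> 0 < i \<and> i < m},
       parcs = (let A = {(path_vertex m u v i, path_vertex m u v (Suc i)) |u v i.
         (u, v) \<in> parcs G \<and> u < v \<and> i < m} in A \<union> A\<inverse>) \<rparr>"


section \<open>The two parameters\<close>

text \<open>The minima are taken in \<open>enat\<close>, so that a minimum over the empty set is \<open>\<infinity>\<close>.\<close>

definition rl_p :: "'a pair_pre_digraph \<Rightarrow> enat" where
  "rl_p G = Inf (enat ` {k. k_locatable k G})"

definition rl_s :: "'a::linorder pair_pre_digraph \<Rightarrow> enat" where
  "rl_s G = Inf (enat ` {s. 0 < s \<and> (\<forall>m\<ge>s. locatable (edge_subdivision m G))})"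

end

theory Submission
  imports Defs
begin

text \<open>
  The graph is the half graph with two sides of \<open>N = 2\<^sup>m\<close> nodes \<open>0, \<dots>, N - 1\<close>, in which \<open>p\<close> and \<open>q\<close> of
  different sides are adjacent iff \<open>p + q < N\<close>. Distances within a side are 2, those between the
  sides 1 or 3, so a probe compares the nodes of the opposite side with a threshold, singles out one
  node of its own side, and tells nothing else. Put \<open>h = N / 2 = 2\<^sup>m\<^sup>-\<^sup>1\<close>. The nodes up to \<open>h\<close> of the two
  sides form a complete bipartite graph in which one edge is missing, that between the two nodes \<open>h\<close>;
  the larger nodes provide the thresholds that tell these apart.

  \<^item> \<open>rl\<^sub>p = h\<close>. Thresholds and singletons are nested or disjoint, so fewer than \<open>h\<close> probes leave two of the \<open>h + 1\<close>
  nodes up to \<open>h\<close> of a given side unresolved (\<open>unresolved_pair\<close>). One of the two is adjacent to all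
  nodes up to \<open>h\<close> of the other side, so the robber can cross over and again be in an unresolved
  pair (\<open>half_graph_not_k_locatable\<close>). With \<open>h\<close> probes, \<open>h - 1\<close> of them resolve one side except for
  its nodes from \<open>h - 1\<close> on, and the remaining one searches the other side, on which the robber must
  stay (\<open>win_sweep\<close>). The missing edge makes one probe resolve the nodes \<open>h - 1\<close> and \<open>h\<close> of both sides
  (\<open>win_high\<close>).

  \<^item> \<open>rl\<^sub>s \<le> m\<close>. The graph is bipartite, so a probe of a branch vertex always reveals the robber's place
  along his path; only the two ends of the path are in doubt. The probe made as the robber leaves
  an end is spent on narrowing down that end. This leaves \<open>M - 1 \<ge> m - 1\<close> probes before he can
  reach the other end, enough for a binary search among \<open>h\<close> candidates, namely \<open>0, \<dots>, h - 2\<close> and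
  the class of all nodes from \<open>h - 1\<close> on (\<open>win_chase\<close>). If he arrives in this class without being
  located, the first probe after it is chosen so that he cannot reach the corresponding class on the
  other side without being located; here the missing edge is used again (\<open>win_outer\<close>). So the robber
  changes ends only a bounded number of times, and leaving and returning to one end costs him a
  candidate each time (\<open>win_branches\<close>).

  \<^item> \<open>rl\<^sub>s \<ge> m\<close>. Let the paths have length \<open>M = m - 1\<close>. The robber waits at an unresolved pair of nodes
  until a probe separates it. Such a probe has the same distance to the first points of at least
  \<open>2\<^sup>M\<close> paths from one of the two nodes (\<open>branches_step\<close>). Each later probe sees the ends of
  the remaining paths, one excepted, at no more than two distances, so at least half of the paths can be
  kept (\<open>fan_step\<close>), and at the far ends two nodes remain unresolved.
\<close>


section \<open>Distances\<close>

text \<open>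
  A function that drops by at most one along every arc bounds the length of every walk to its zero from
  below; following arcs along which it drops gives a walk that attains the bound.
\<close>

lemma graph_dist_eqI:
  assumes wf: "pair_wf_digraph G" and u: "u \<in> pverts G" and fu: "f u = (0 :: nat)"
    and lipschitz: "\<And>x y. (x, y) \<in> parcs G \<Longrightarrow> f x \<le> Suc (f y)"
    and descent: "\<And>x. x \<in> pverts G \<Longrightarrow> f x = 0 \<Longrightarrow> x = u"
      "\<And>x. x \<in> pverts G \<Longrightarrow> f x \<noteq> 0 \<Longrightarrow> \<exists>y. (x, y) \<in> parcs G \<and> f x = Suc (f y)"
    and v: "v \<in> pverts G"
  shows "graph_dist G v u = ereal (real (f v))"
proof -
  interpret pair_wf_digraph G by (rule wf)
  have lower: "real (f x) \<le> awalk_cost (\<lambda>_. 1) p" if "awalk x p u" for x p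
    using that
  proof (induction p arbitrary: x)
    case Nil
    then show ?case using fu by (simp add: awalk_Nil_iff)
  next
    case (Cons e p)
    then have "e \<in> parcs G" "fst e = x" "awalk (snd e) p u"
      by (auto simp: awalk_Cons_iff)
    moreover from this have "f x \<le> Suc (f (snd e))"
      using lipschitz[of x "snd e"] by (metis prod.collapse)
    ultimately show ?case using Cons.IH[of "snd e"] by simp
  qed
  have upper: "\<exists>p. awalk x p u \<and> awalk_cost (\<lambda>_. 1) p = real (f x)" if "x \<in> pverts G" for x
    using that
  proof (induction "f x" arbitrary: x)
    case 0
    then have "x = u" using descent(1) by simp
    then show ?case using u fu by (intro exI[of _ "[]"]) (simp add: awalk_Nil_iff)
  next
    case (Suc k)
    then obtain y where y: "(x, y) \<in> parcs G" "f x = Suc (f y)" using descent(2)[of x] by auto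
    then obtain p where "awalk y p u" "awalk_cost (\<lambda>_. 1) p = real (f y)"
      using Suc(1)[of y] Suc(2) by (auto dest: in_arcsD2)
    then show ?case using y by (intro exI[of _ "(x, y) # p"]) (auto simp: awalk_Cons_iff in_arcsD1)
  qed
  obtain p where p: "awalk v p u" "awalk_cost (\<lambda>_. 1) p = real (f v)" using upper[OF v] by blast
  show ?thesis
    unfolding graph_dist_def \<mu>_def
  proof (rule antisym)
    show "(INF p\<in>{p. awalk v p u}. ereal (awalk_cost (\<lambda>_. 1) p)) \<le> ereal (real (f v))"
      using p by (intro INF_lower2[of p]) auto
    show "ereal (real (f v)) \<le> (INF p\<in>{p. awalk v p u}. ereal (awalk_cost (\<lambda>_. 1) p))"
      using lower by (intro INF_greatest) auto
  qed
qed


section \<open>The game as a game on sets of possible positions\<close>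

definition closed_nbhd :: "'a pair_pre_digraph \<Rightarrow> 'a set \<Rightarrow> 'a set" where
  "closed_nbhd G T = T \<union> parcs G `` T"

definition replies :: "'a pair_pre_digraph \<Rightarrow> 'a list \<Rightarrow> 'a \<Rightarrow> ereal list" where
  "replies G us v = map (\<lambda>u. graph_dist G v u) us"

text \<open>
  A set \<open>T\<close> consists of the positions that are compatible with the answers up to now, taken just after
  an answer. The robber then moves, and the next answer cuts the closed neighbourhood of \<open>T\<close> down to
  one of its classes.
\<close>

inductive cop_wins :: "nat \<Rightarrow> 'a pair_pre_digraph \<Rightarrow> 'a set \<Rightarrow> bool" for k G where
  located: "(\<And>x y. x \<in> T \<Longrightarrow> y \<in> T \<Longrightarrow> x = y) \<Longrightarrow> cop_wins k G T"
| probe: "length us = k \<Longrightarrow> set us \<subseteq> pverts G \<Longrightarrow>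
    (\<And>d. cop_wins k G {v \<in> closed_nbhd G T. replies G us v = d}) \<Longrightarrow> cop_wins k G T"

lemma closed_nbhd_mono: "T' \<subseteq> T \<Longrightarrow> closed_nbhd G T' \<subseteq> closed_nbhd G T"
  by (auto simp: closed_nbhd_def)

lemma cop_wins_mono:
  assumes "cop_wins k G T" "T' \<subseteq> T"
  shows "cop_wins k G T'"
  using assms
proof (induction arbitrary: T')
  case (located T)
  show ?case by (rule cop_wins.located) (use located in blast)
next
  case (probe us T)
  show ?case
  proof (rule cop_wins.probe[OF probe(1,2)])
    fix d
    have "{v \<in> closed_nbhd G T'. replies G us v = d} \<subseteq> {v \<in> closed_nbhd G T. replies G us v = d}"
      using closed_nbhd_mono[OF probe(5), of G] by blast
    then show "cop_wins k G {v \<in> closed_nbhd G T'. replies G us v = d}" by (rule probe(4))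
  qed
qed

lemma cop_wins_probeI:
  assumes "length us = k" "set us \<subseteq> pverts G"
    and cases: "\<And>v. v \<in> closed_nbhd G T \<Longrightarrow> \<exists>T'. cop_wins k G T' \<and>
      (\<forall>v' \<in> closed_nbhd G T. replies G us v' = replies G us v \<longrightarrow> v' \<in> T')"
  shows "cop_wins k G T"
proof (rule cop_wins.probe[OF assms(1,2)])
  fix d
  show "cop_wins k G {v \<in> closed_nbhd G T. replies G us v = d}"
  proof (cases "\<exists>v \<in> closed_nbhd G T. replies G us v = d")
    case True
    then obtain v where v: "v \<in> closed_nbhd G T" "replies G us v = d" by blast
    obtain T' where "cop_wins k G T'"
      "\<forall>v' \<in> closed_nbhd G T. replies G us v' = replies G us v \<longrightarrow> v' \<in> T'"
      using cases[OF v(1)] by blast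
    then show ?thesis using v(2) by (auto intro: cop_wins_mono)
  next
    case False
    then show ?thesis by (auto intro: cop_wins.located)
  qed
qed

lemma answers_Suc_shift:
  "answers G \<sigma> w (Suc n) = replies G (\<sigma> []) (w 0) #
     answers G (\<lambda>h. \<sigma> (replies G (\<sigma> []) (w 0) # h)) (\<lambda>i. w (Suc i)) n"
proof (induction n)
  case 0
  show ?case by (simp add: replies_def)
next
  case (Suc n)
  have "answers G \<sigma> w (Suc (Suc n)) =
      answers G \<sigma> w (Suc n) @ [replies G (\<sigma> (answers G \<sigma> w (Suc n))) (w (Suc n))]"
    by (subst answers.simps(2)) (simp only: replies_def)
  also have "\<dots> = replies G (\<sigma> []) (w 0) #
      answers G (\<lambda>h. \<sigma> (replies G (\<sigma> []) (w 0) # h)) (\<lambda>i. w (Suc i)) (Suc n)"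
    by (subst (1 2) Suc.IH) (simp only: answers.simps(2) append_Cons replies_def)
  finally show ?case .
qed

lemma robber_walk_shift:
  assumes "pair_wf_digraph G" "robber_walk G w"
  shows "robber_walk G (\<lambda>i. w (Suc i))"
proof -
  interpret pair_wf_digraph G by (rule assms(1))
  have "w 0 \<in> pverts G" "w (Suc 0) = w 0 \<or> (w 0, w (Suc 0)) \<in> parcs G"
    using assms(2) by (auto simp: robber_walk_def)
  then have "w (Suc 0) \<in> pverts G" by (auto dest: in_arcsD2)
  then show ?thesis using assms(2) by (simp add: robber_walk_def)
qed

lemma robber_walk_step:
  assumes "robber_walk G w" "w n \<in> T"
  shows "w (Suc n) \<in> closed_nbhd G T"
proof -
  have "w (Suc n) = w n \<or> (w n, w (Suc n)) \<in> parcs G"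
    using assms(1) by (simp add: robber_walk_def)
  then show ?thesis using assms(2) by (auto simp: closed_nbhd_def)
qed

text \<open>
  The cop assembles a strategy from the winning sets: her first probes come from the derivation, and
  after each possible answer she continues with the strategy for the set of positions left by it.
\<close>

lemma cop_wins_strategy:
  assumes wf: "pair_wf_digraph G" and "cop_wins k G T"
  shows "(\<forall>x \<in> T. \<forall>y \<in> T. x = y) \<or>
    (\<exists>\<sigma>. probe_strategy k G \<sigma> \<and> (\<forall>w. robber_walk G w \<and> w 0 \<in> closed_nbhd G T \<longrightarrow>
      (\<exists>n. \<forall>w'. robber_walk G w' \<and> w' 0 \<in> closed_nbhd G T \<and>
        answers G \<sigma> w' (Suc n) = answers G \<sigma> w (Suc n) \<longrightarrow> w' n = w n)))"
  using assms(2)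
proof induction
  case (located T)
  then show ?case by blast
next
  case (probe us T)
  define C where "C d = {v \<in> closed_nbhd G T. replies G us v = d}" for d
  define good where "good d \<tau> \<longleftrightarrow> probe_strategy k G \<tau> \<and>
      (\<forall>w. robber_walk G w \<and> w 0 \<in> closed_nbhd G (C d) \<longrightarrow>
      (\<exists>n. \<forall>w'. robber_walk G w' \<and> w' 0 \<in> closed_nbhd G (C d) \<and>
        answers G \<tau> w' (Suc n) = answers G \<tau> w (Suc n) \<longrightarrow> w' n = w n))" for d \<tau>
  have C: "(\<forall>x \<in> C d. \<forall>y \<in> C d. x = y) \<or> (\<exists>\<tau>. good d \<tau>)" for d
    using probe(4)[of d] unfolding C_def good_def .
  define \<tau> where "\<tau> d = (if \<exists>\<tau>. good d \<tau> then SOME \<tau>. good d \<tau> else (\<lambda>_. us))" for d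
  have \<tau>_good: "good d (\<tau> d)" if "\<exists>\<tau>. good d \<tau>" for d
    using that someI_ex[of "good d"] by (simp add: \<tau>_def)
  have \<tau>_probe: "probe_strategy k G (\<tau> d)" for d
  proof (cases "\<exists>\<tau>. good d \<tau>")
    case True
    then show ?thesis using \<tau>_good[of d] by (simp add: good_def)
  next
    case False
    then show ?thesis using probe(1,2) by (simp add: \<tau>_def probe_strategy_def)
  qed
  define \<sigma> where "\<sigma> h = (case h of [] \<Rightarrow> us | d # h' \<Rightarrow> \<tau> d h')" for h
  have \<sigma>: "\<sigma> [] = us" "(\<lambda>h. \<sigma> (d # h)) = \<tau> d" for d by (simp_all add: \<sigma>_def)
  have "probe_strategy k G \<sigma>"
    using probe(1,2) \<tau>_probe by (auto simp: probe_strategy_def \<sigma>_def split: list.split)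
  moreover have "\<exists>n. \<forall>w'. robber_walk G w' \<and> w' 0 \<in> closed_nbhd G T \<and>
        answers G \<sigma> w' (Suc n) = answers G \<sigma> w (Suc n) \<longrightarrow> w' n = w n"
    if w: "robber_walk G w" "w 0 \<in> closed_nbhd G T" for w
  proof -
    define d where "d = replies G us (w 0)"
    have wC: "w 0 \<in> C d" using w by (simp add: C_def d_def)
    from C[of d] show ?thesis
    proof
      assume "\<forall>x \<in> C d. \<forall>y \<in> C d. x = y"
      then have "w' 0 = w 0" if "w' 0 \<in> closed_nbhd G T"
          "answers G \<sigma> w' (Suc 0) = answers G \<sigma> w (Suc 0)" for w'
        using that wC by (auto simp: \<sigma> C_def d_def replies_def)
      then show ?thesis by blast
    next
      assume "\<exists>\<tau>. good d \<tau>"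
      then have "good d (\<tau> d)" by (rule \<tau>_good)
      moreover have "robber_walk G (\<lambda>i. w (Suc i))" using wf w(1) by (rule robber_walk_shift)
      moreover have "w (Suc 0) \<in> closed_nbhd G (C d)" using w(1) wC by (rule robber_walk_step)
      ultimately obtain n where n: "\<And>w'. robber_walk G w' \<Longrightarrow> w' 0 \<in> closed_nbhd G (C d) \<Longrightarrow>
          answers G (\<tau> d) w' (Suc n) = answers G (\<tau> d) (\<lambda>i. w (Suc i)) (Suc n) \<Longrightarrow>
          w' n = w (Suc n)"
        unfolding good_def by blast
      have "w' (Suc n) = w (Suc n)" if w': "robber_walk G w'" "w' 0 \<in> closed_nbhd G T"
        "answers G \<sigma> w' (Suc (Suc n)) = answers G \<sigma> w (Suc (Suc n))" for w'
      proof -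
        have d': "replies G us (w' 0) = d" and
          eq: "answers G (\<tau> d) (\<lambda>i. w' (Suc i)) (Suc n) = answers G (\<tau> d) (\<lambda>i. w (Suc i)) (Suc n)"
          using w'(3) unfolding answers_Suc_shift[of G \<sigma> _ "Suc n"] \<sigma> d_def by auto
        have "w' 0 \<in> C d" using w'(2) d' by (simp add: C_def)
        then have "w' (Suc 0) \<in> closed_nbhd G (C d)" using w'(1) by (intro robber_walk_step)
        with n[OF robber_walk_shift[OF wf w'(1)]] eq show ?thesis by (simp only:)
      qed
      then show ?thesis by blast
    qed
  qed
  ultimately show ?case by blast
qed

lemma k_locatable_if_cop_wins:
  assumes wf: "pair_wf_digraph G" and ne: "pverts G \<noteq> {}" and win: "cop_wins k G (pverts G)"
  shows "k_locatable k G"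
proof -
  interpret pair_wf_digraph G by (rule wf)
  have V: "closed_nbhd G (pverts G) = pverts G" by (auto simp: closed_nbhd_def dest: in_arcsD2)
  have w0: "w 0 \<in> pverts G" if "robber_walk G w" for w using that by (simp add: robber_walk_def)
  from cop_wins_strategy[OF wf win] show ?thesis
  proof
    assume single: "\<forall>x \<in> pverts G. \<forall>y \<in> pverts G. x = y"
    obtain v where "v \<in> pverts G" using ne by blast
    then have "probe_strategy k G (\<lambda>_. replicate k v)" by (auto simp: probe_strategy_def)
    moreover have "located_at G (\<lambda>_. replicate k v) w 0" if "robber_walk G w" for w
      using w0 that single by (auto simp: located_at_def)
    ultimately show ?thesis unfolding k_locatable_def by blast
  next
    assume "\<exists>\<sigma>. probe_strategy k G \<sigma> \<and> (\<forall>w. robber_walk G w \<and> w 0 \<in> closed_nbhd G (pverts G) \<longrightarrow>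
      (\<exists>n. \<forall>w'. robber_walk G w' \<and> w' 0 \<in> closed_nbhd G (pverts G) \<and>
        answers G \<sigma> w' (Suc n) = answers G \<sigma> w (Suc n) \<longrightarrow> w' n = w n))"
    moreover have "robber_walk G w \<and> w 0 \<in> closed_nbhd G (pverts G) \<longleftrightarrow> robber_walk G w" for w
      using w0[of w] V by blast
    ultimately show ?thesis unfolding k_locatable_def located_at_def conj_assoc[symmetric] by simp
  qed
qed

text \<open>
  Koenig's lemma, in the form in which the robber uses it: if every member of each set has a
  predecessor in the set before, some sequence runs through all the sets.
\<close>

lemma infinite_chain:
  fixes T :: "nat \<Rightarrow> 'a set"
  assumes fin: "\<And>n. finite (T n)" and ne: "\<And>n. T n \<noteq> {}"
    and pred: "\<And>n y. y \<in> T (Suc n) \<Longrightarrow> \<exists>x \<in> T n. R x y"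
  shows "\<exists>w. \<forall>n. w n \<in> T n \<and> R (w n) (w (Suc n))"
proof -
  define ext where "ext = rec_nat (\<lambda>n x. x \<in> T n) (\<lambda>_ e n x. x \<in> T n \<and> (\<exists>y. R x y \<and> e (Suc n) y))"
  have ext: "ext 0 n x \<longleftrightarrow> x \<in> T n"
    "ext (Suc j) n x \<longleftrightarrow> x \<in> T n \<and> (\<exists>y. R x y \<and> ext j (Suc n) y)" for j n x
    by (simp_all add: ext_def)
  have ext_T: "x \<in> T n" if "ext j n x" for j n x using that by (cases j) (auto simp: ext)
  have ext_ne: "\<exists>x. ext j n x" for j n
  proof (induction j arbitrary: n)
    case 0
    then show ?case using ne by (auto simp: ext)
  next
    case (Suc j)
    then obtain y where "ext j (Suc n) y" by blast
    then show ?case using pred[of y n] by (auto simp: ext dest: ext_T)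
  qed
  have ext_Suc: "ext j n x" if "ext (Suc j) n x" for j n x
    using that by (induction j arbitrary: n x) (auto simp: ext)
  have ext_mono: "ext i n x" if "ext j n x" "i \<le> j" for i j n x
    using that(2,1) by (induction rule: dec_induct) (auto dest: ext_Suc)
  \<comment> \<open>In a finite set, points satisfying ever stronger conditions leave one that satisfies them all.\<close>
  have compact: "\<exists>x. Q x \<and> (\<forall>j. ext j n x)" if Q: "\<And>j. \<exists>x. Q x \<and> ext j n x" for Q n
  proof (rule ccontr)
    assume "\<not> ?thesis"
    then obtain b where b: "\<And>x. Q x \<Longrightarrow> \<not> ext (b x) n x" by metis
    obtain x where x: "Q x" "ext (Max (b ` T n)) n x" using Q by blast
    have "b x \<le> Max (b ` T n)" using fin ext_T[OF x(2)] by simp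
    then show False using b[OF x(1)] ext_mono[OF x(2)] by blast
  qed
  have start: "\<exists>x. \<forall>j. ext j 0 x" using compact[of "\<lambda>_. True" 0] ext_ne by blast
  have step: "\<exists>y. (\<forall>j. ext j (Suc n) y) \<and> R x y" if "\<forall>j. ext j n x" for n x
    using compact[of "R x" "Suc n"] that ext(2) by blast
  have "\<exists>w. \<forall>n. (\<forall>j. ext j n (w n)) \<and> R (w n) (w (Suc n))"
    by (rule dependent_nat_choice[of "\<lambda>n x. \<forall>j. ext j n x" "\<lambda>_. R", OF start step])
  then show ?thesis using ext_T by blast
qed

text \<open>
  The robber escapes if he can keep the set of positions consistent with the answers inside a family
  of sets none of which is a singleton.
\<close>

lemma not_k_locatable_if_evasive:
  assumes G: "pair_wf_digraph G" "finite (pverts G)"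
    and family: "\<And>T. T \<in> F \<Longrightarrow> T \<subseteq> pverts G \<and> (\<exists>x \<in> T. \<exists>y \<in> T. x \<noteq> y)" and ne: "F \<noteq> {}"
    and evade: "\<And>T us. T \<in> F \<Longrightarrow> length us = k \<Longrightarrow> set us \<subseteq> pverts G \<Longrightarrow>
      \<exists>T' \<in> F. T' \<subseteq> closed_nbhd G T \<and> (\<forall>x \<in> T'. \<forall>y \<in> T'. replies G us x = replies G us y)"
  shows "\<not> k_locatable k G"
proof
  interpret pair_wf_digraph G by (rule G(1))
  assume "k_locatable k G"
  then obtain \<sigma> where \<sigma>: "probe_strategy k G \<sigma>"
    and win: "\<And>w. robber_walk G w \<Longrightarrow> \<exists>n. located_at G \<sigma> w n"
    unfolding k_locatable_def by blast
  have us: "length (\<sigma> h) = k" "set (\<sigma> h) \<subseteq> pverts G" for h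
    using \<sigma> by (auto simp: probe_strategy_def)
  define good where "good S T d us \<longleftrightarrow> T \<in> F \<and> T \<subseteq> closed_nbhd G S \<and> (\<forall>x \<in> T. replies G us x = d)"
    for S T d us
  have next_set: "\<exists>T' d. good T T' d (\<sigma> h)" if T: "T \<in> F" for T h
  proof -
    obtain T' where T': "T' \<in> F" "T' \<subseteq> closed_nbhd G T"
      "\<forall>x \<in> T'. \<forall>y \<in> T'. replies G (\<sigma> h) x = replies G (\<sigma> h) y"
      using evade[OF T us] by blast
    then show ?thesis using family[OF T'(1)] unfolding good_def by blast
  qed
  obtain T0 where T0: "T0 \<in> F" using ne by blast
  \<comment> \<open>Play against the strategy: the state is the history of answers and the current set.\<close>
  have "\<exists>s. \<forall>n. snd (s n) \<in> F \<and>
    (\<exists>d. fst (s (Suc n)) = fst (s n) @ [d] \<and> good (snd (s n)) (snd (s (Suc n))) d (\<sigma> (fst (s n))))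
    \<and> (n = 0 \<longrightarrow> fst (s n) = [])"
  proof -
    have "\<exists>s. \<forall>n. (snd (s n) \<in> F \<and> (n = 0 \<longrightarrow> fst (s n) = [])) \<and>
      (\<exists>d. fst (s (Suc n)) = fst (s n) @ [d] \<and> good (snd (s n)) (snd (s (Suc n))) d (\<sigma> (fst (s n))))"
    proof (rule dependent_nat_choice)
      show "\<exists>x. snd x \<in> F \<and> (0 = 0 \<longrightarrow> fst x = [])" using T0 by (intro exI[of _ "([], T0)"]) simp
    next
      fix x :: "ereal list list \<times> 'a set" and n :: nat
      assume x: "snd x \<in> F \<and> (n = 0 \<longrightarrow> fst x = [])"
      then obtain T' d where "good (snd x) T' d (\<sigma> (fst x))" using next_set by blast
      then show "\<exists>y. (snd y \<in> F \<and> (Suc n = 0 \<longrightarrow> fst y = [])) \<and>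
          (\<exists>d. fst y = fst x @ [d] \<and> good (snd x) (snd y) d (\<sigma> (fst x)))"
        by (intro exI[of _ "(fst x @ [d], T')"]) (auto simp: good_def)
    qed
    then show ?thesis by blast
  qed
  then obtain s where s': "\<forall>n. snd (s n) \<in> F \<and>
    (\<exists>d. fst (s (Suc n)) = fst (s n) @ [d] \<and> good (snd (s n)) (snd (s (Suc n))) d (\<sigma> (fst (s n))))
    \<and> (n = 0 \<longrightarrow> fst (s n) = [])" by (elim exE)
  then have "\<forall>n. \<exists>d. fst (s (Suc n)) = fst (s n) @ [d] \<and>
      good (snd (s n)) (snd (s (Suc n))) d (\<sigma> (fst (s n)))" by blast
  then obtain d where "\<forall>n. fst (s (Suc n)) = fst (s n) @ [d n] \<and>
      good (snd (s n)) (snd (s (Suc n))) (d n) (\<sigma> (fst (s n)))" by (rule choice[THEN exE])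
  with s' have s: "\<And>n. snd (s n) \<in> F" "fst (s 0) = []"
    "\<And>n. fst (s (Suc n)) = fst (s n) @ [d n]"
    "\<And>n. good (snd (s n)) (snd (s (Suc n))) (d n) (\<sigma> (fst (s n)))"
    by simp_all
  define T where "T n = snd (s (Suc n))" for n
  have T: "T n \<in> F" "T n \<subseteq> pverts G" "\<exists>x \<in> T n. \<exists>y \<in> T n. x \<noteq> y" for n
    using s(1) family[OF s(1)] by (simp_all add: T_def)
  have T_reply: "replies G (\<sigma> (fst (s n))) x = d n" if "x \<in> T n" for n x
    using s(4)[of n] that by (simp add: good_def T_def)
  define move where "move x y \<longleftrightarrow> y = x \<or> (x, y) \<in> parcs G" for x y
  have move_back: "\<exists>x \<in> T n. move x y" if "y \<in> T (Suc n)" for n y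
    using s(4)[of "Suc n"] that by (auto simp: good_def T_def move_def closed_nbhd_def)
  have T_fin: "finite (T n)" for n using finite_subset[OF T(2) G(2)] .
  have ans: "answers G \<sigma> w n = fst (s n)" if "\<And>i. i < n \<Longrightarrow> w i \<in> T i" for w n
    using that
  proof (induction n)
    case (Suc n)
    then show ?case using T_reply[of "w n" n] by (simp add: s(3) replies_def)
  qed (simp add: s(2))
  have walkI: "robber_walk G w" if "w 0 \<in> T 0" "\<And>i. move (w i) (w (Suc i))" for w
    using that T(2)[of 0] by (auto simp: robber_walk_def move_def)
  obtain w where w: "\<And>n. w n \<in> T n" "\<And>n. move (w n) (w (Suc n))"
    using infinite_chain[of T move] T_fin T(3) move_back by blast
  obtain n where n: "located_at G \<sigma> w n" using win walkI[of w] w by blast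
  obtain y where y: "y \<in> T n" "y \<noteq> w n" using T(3)[of n] by blast
  \<comment> \<open>A second walk to \<open>y\<close> through the same sets, which stops there.\<close>
  have "\<exists>c. c n = y \<and> (\<forall>i \<le> n. c i \<in> T i) \<and> (\<forall>i. move (c i) (c (Suc i)))" using y(1)
  proof (induction n arbitrary: y)
    case 0
    then show ?case by (intro exI[of _ "\<lambda>_. y"]) (auto simp: move_def)
  next
    case (Suc n)
    then obtain x where x: "x \<in> T n" "move x y" using move_back by blast
    from Suc.IH[OF x(1)] obtain c where c: "c n = x" "\<forall>i \<le> n. c i \<in> T i" "\<forall>i. move (c i) (c (Suc i))"
      by blast
    show ?case using c x(2) Suc.prems
      by (intro exI[of _ "\<lambda>i. if i \<le> n then c i else y"]) (auto simp: move_def le_Suc_eq not_less_eq_eq dest: le_antisym)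
  qed
  then obtain c where c: "c n = y" "\<And>i. i \<le> n \<Longrightarrow> c i \<in> T i" "\<And>i. move (c i) (c (Suc i))" by blast
  have "answers G \<sigma> c (Suc n) = answers G \<sigma> w (Suc n)"
    using ans[of "Suc n" c] ans[of "Suc n" w] c(2) w(1) by simp
  moreover have "robber_walk G c" using walkI[of c] c(2)[of 0] c(3) by simp
  ultimately show False using n y(2) c(1) by (auto simp: located_at_def)
qed

section \<open>Half graphs\<close>

text \<open>
  The nodes of both sides are numbered from \<open>0\<close>. The first side comes first in the ordering of the
  vertices, which fixes the orientation of the subdivided edges.
\<close>

definition node :: "nat \<Rightarrow> bool \<Rightarrow> nat \<Rightarrow> nat" where
  "node N \<sigma> p = (if \<sigma> then p else N + p)"

definition half_graph :: "nat \<Rightarrow> nat pair_pre_digraph" where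
  "half_graph N = \<lparr> pverts = {..<2 * N},
     parcs = {(node N \<sigma> p, node N (\<not> \<sigma>) q) |\<sigma> p q. p + q < N} \<rparr>"

lemma node_eq_iff:
  assumes "p < N" "q < N"
  shows "node N \<sigma> p = node N \<tau> q \<longleftrightarrow> \<sigma> = \<tau> \<and> p = q"
  using assms by (auto simp: node_def)

lemma half_graph_verts: "v \<in> pverts (half_graph N) \<longleftrightarrow> (\<exists>\<sigma>. \<exists>p < N. v = node N \<sigma> p)"
proof
  assume "v \<in> pverts (half_graph N)"
  then have v: "v < 2 * N" by (simp add: half_graph_def)
  show "\<exists>\<sigma>. \<exists>p < N. v = node N \<sigma> p"
  proof (cases "v < N")
    case True
    then show ?thesis by (intro exI[of _ True] exI[of _ v]) (simp add: node_def)
  next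
    case False
    then show ?thesis using v by (intro exI[of _ False] exI[of _ "v - N"]) (simp add: node_def)
  qed
qed (auto simp: half_graph_def node_def)

lemma half_graph_arcs:
  "(x, y) \<in> parcs (half_graph N) \<longleftrightarrow> (\<exists>\<sigma> p q. p + q < N \<and> x = node N \<sigma> p \<and> y = node N (\<not> \<sigma>) q)"
  by (auto simp: half_graph_def)

lemma half_graph_wf: "pair_wf_digraph (half_graph N)"
proof
  fix e assume "e \<in> parcs (half_graph N)"
  then obtain \<sigma> p q where e: "p + q < N" "e = (node N \<sigma> p, node N (\<not> \<sigma>) q)"
    by (auto simp: half_graph_def)
  then have "p < N" "q < N" by linarith+
  then show "fst e \<in> pverts (half_graph N)" "snd e \<in> pverts (half_graph N)"
    unfolding half_graph_verts e(2) fst_conv snd_conv by blast+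
qed

lemma half_graph_pair_graph: "pair_graph (half_graph N)"
proof -
  interpret pair_wf_digraph "half_graph N" by (rule half_graph_wf)
  have fin: "finite (pverts (half_graph N))" by (simp add: half_graph_def)
  have "parcs (half_graph N) \<subseteq> pverts (half_graph N) \<times> pverts (half_graph N)"
    using in_arcsD1 in_arcsD2 by auto
  then have fin_arcs: "finite (parcs (half_graph N))" using fin by (auto intro: finite_subset)
  have sym: "(y, x) \<in> parcs (half_graph N)" if "(x, y) \<in> parcs (half_graph N)" for x y
  proof -
    obtain \<sigma> p q where "p + q < N" "x = node N \<sigma> p" "y = node N (\<not> \<sigma>) q"
      using \<open>(x, y) \<in> _\<close> unfolding half_graph_arcs by blast
    then show ?thesis unfolding half_graph_arcs
      by (intro exI[of _ "\<not> \<sigma>"] exI[of _ q] exI[of _ p]) simp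
  qed
  show ?thesis
  proof
    show "finite (pverts (half_graph N))" "finite (parcs (half_graph N))" by fact+
    show "symmetric (with_proj (half_graph N))"
      using sym by (auto simp: symmetric_def intro: symI)
    show "fst e \<noteq> snd e" if "e \<in> parcs (half_graph N)" for e
      using that by (auto simp: half_graph_def node_def split: if_splits)
  qed
qed

text \<open>
  Two nodes of one side have the common neighbour \<open>0\<close>, and two nonadjacent nodes of different sides
  are joined by the path through the two nodes \<open>0\<close>.
\<close>

lemma half_graph_dist:
  assumes "p < N" "q < N"
  shows "graph_dist (half_graph N) (node N \<sigma> p) (node N \<tau> q) = ereal (real (
    if \<sigma> = \<tau> then (if p = q then 0 else 2) else (if p + q < N then 1 else 3)))"
proof -
  define D where "D \<sigma> p = (if \<sigma> = \<tau> then (if p = q then 0 else 2) else (if p + q < N then 1 else (3 :: nat)))"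
    for \<sigma> p
  define f where "f v = D (v < N) (if v < N then v else v - N)" for v
  have f: "f (node N \<sigma> p) = D \<sigma> p" if "p < N" for \<sigma> p using that by (simp add: f_def node_def)
  have "graph_dist (half_graph N) (node N \<sigma> p) (node N \<tau> q) = ereal (real (f (node N \<sigma> p)))"
  proof (rule graph_dist_eqI[OF half_graph_wf])
    show "node N \<tau> q \<in> pverts (half_graph N)" "node N \<sigma> p \<in> pverts (half_graph N)"
      using assms by (auto simp: half_graph_verts)
    show "f (node N \<tau> q) = 0" using f[OF assms(2)] by (simp add: D_def)
    show "f x \<le> Suc (f y)" if "(x, y) \<in> parcs (half_graph N)" for x y
    proof -
      obtain \<sigma> p r where "p + r < N" "x = node N \<sigma> p" "y = node N (\<not> \<sigma>) r"
        using \<open>(x, y) \<in> _\<close> unfolding half_graph_arcs by blast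
      then show ?thesis using f[of p \<sigma>] f[of r "\<not> \<sigma>"] by (auto simp: D_def)
    qed
    show "x = node N \<tau> q" if "x \<in> pverts (half_graph N)" "f x = 0" for x
      using that f by (auto simp: half_graph_verts D_def split: if_splits)
    show "\<exists>y. (x, y) \<in> parcs (half_graph N) \<and> f x = Suc (f y)"
      if x_vert: "x \<in> pverts (half_graph N)" and fx: "f x \<noteq> 0" for x
    proof -
      obtain \<sigma> p where x: "p < N" "x = node N \<sigma> p" using x_vert unfolding half_graph_verts by blast
      have step: ?thesis if "p + r < N" "D \<sigma> p = Suc (D (\<not> \<sigma>) r)" for r
        using that x f[of p \<sigma>] f[of r "\<not> \<sigma>"] unfolding half_graph_arcs
        by (intro exI[of _ "node N (\<not> \<sigma>) r"]) auto
      have "D \<sigma> p \<noteq> 0" using fx x f by simp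
      then show ?thesis
        using step[of 0] step[of q] x(1) assms(2) by (auto simp: D_def split: if_splits)
    qed
  qed
  then show ?thesis using f[OF assms(1)] by (simp add: D_def)
qed

lemma half_graph_connected:
  assumes "N > 0"
  shows "connected (with_proj (half_graph N))"
proof -
  interpret pair_graph "half_graph N" by (rule half_graph_pair_graph)
  have "u \<rightarrow>\<^sup>*\<^bsub>with_proj (half_graph N)\<^esub> v" if "u \<in> pverts (half_graph N)" "v \<in> pverts (half_graph N)" for u v
  proof (rule ccontr)
    assume "\<not> u \<rightarrow>\<^sup>*\<^bsub>with_proj (half_graph N)\<^esub> v"
    then have "graph_dist (half_graph N) u v = \<infinity>"
      unfolding graph_dist_def by (rule shortest_path_inf)
    moreover have "graph_dist (half_graph N) u v \<noteq> \<infinity>"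
      using that by (auto simp: half_graph_verts half_graph_dist)
    ultimately show False by blast
  qed
  moreover have "0 \<in> pverts (half_graph N)" using assms by (simp add: half_graph_def)
  ultimately show ?thesis
    unfolding connected_def strongly_connected_def by (auto intro: reachable_mk_symmetricI)
qed


section \<open>Distances in subdivided half graphs\<close>

text \<open>
  The point at distance \<open>i\<close> from node \<open>p\<close> of side \<open>\<sigma>\<close> on the path towards node \<open>q\<close> of the other side.
  Every point has a description from either side, so statements need to be proved for one side only.
\<close>

definition pos :: "nat \<Rightarrow> nat \<Rightarrow> bool \<Rightarrow> nat \<Rightarrow> nat \<Rightarrow> nat \<Rightarrow> nat sub_vertex" where
  "pos N M \<sigma> p q i =
     (if \<sigma> then path_vertex M p (N + q) i else path_vertex M q (N + p) (M - i))"

text \<open>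
  Distances to the point at distance \<open>s\<close> from \<open>u\<close> on the path from \<open>u\<close> to \<open>v\<close>. From node \<open>p\<close> on the side
  of \<open>u\<close> a shortest walk comes in through \<open>v\<close> if \<open>p\<close> is adjacent to \<open>v\<close>, and otherwise makes a detour
  to \<open>u\<close> through a common neighbour. A point on another path has to leave its path through one of its
  ends; for node \<open>q\<close> on the side of \<open>v\<close> the roles of \<open>u\<close> and \<open>v\<close> are exchanged.
\<close>

definition end_dist :: "nat \<Rightarrow> nat \<Rightarrow> nat \<Rightarrow> nat \<Rightarrow> nat \<Rightarrow> nat \<Rightarrow> nat" where
  "end_dist N M u v s p = (if p = u then s else if p + v < N then 2 * M - s else 2 * M + s)"

definition pos_dist :: "nat \<Rightarrow> nat \<Rightarrow> nat \<Rightarrow> nat \<Rightarrow> nat \<Rightarrow> nat \<Rightarrow> nat \<Rightarrow> nat \<Rightarrow> nat" where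
  "pos_dist N M u v s p q i =
     (if p = u \<and> q = v then (if i \<le> s then s - i else i - s)
      else min (end_dist N M u v s p + i) (end_dist N M v u (M - s) q + (M - i)))"

lemma pos_dist_flip:
  assumes "s \<le> M" "i \<le> M"
  shows "pos_dist N M v u (M - s) q p (M - i) = pos_dist N M u v s p q i"
  using assms by (auto simp: pos_dist_def min.commute)

lemma pos_dist_start:
  assumes "u + v < N" "p + q < N" "s \<le> M"
  shows "pos_dist N M u v s p q 0 = end_dist N M u v s p"
  using assms by (auto simp: pos_dist_def end_dist_def min_def)

lemma pos_dist_step:
  assumes "i < M"
  shows "pos_dist N M u v s p q (Suc i) \<le> Suc (pos_dist N M u v s p q i)"
    "pos_dist N M u v s p q i \<le> Suc (pos_dist N M u v s p q (Suc i))"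
proof -
  define a b where "a = end_dist N M u v s p" and "b = end_dist N M v u (M - s) q"
  have "pos_dist N M u v s p q (Suc i) \<le> Suc (pos_dist N M u v s p q i) \<and>
    pos_dist N M u v s p q i \<le> Suc (pos_dist N M u v s p q (Suc i))"
  proof (cases "p = u \<and> q = v")
    case True
    then have eq: "pos_dist N M u v s p q j = (if j \<le> s then s - j else j - s)" for j
      by (simp add: pos_dist_def)
    show ?thesis unfolding eq by auto
  next
    case False
    then have eq: "pos_dist N M u v s p q j = min (a + j) (b + (M - j))" for j
      unfolding pos_dist_def a_def b_def by (rule if_not_P)
    have "M - i = Suc (M - Suc i)" using assms by simp
    then show ?thesis unfolding eq by linarith
  qed
  then show "pos_dist N M u v s p q (Suc i) \<le> Suc (pos_dist N M u v s p q i)"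
    "pos_dist N M u v s p q i \<le> Suc (pos_dist N M u v s p q (Suc i))" by blast+
qed

lemma pos_dist_descent:
  assumes "0 < i" "i < M" "pos_dist N M u v s p q i \<noteq> 0"
  shows "pos_dist N M u v s p q i = Suc (pos_dist N M u v s p q (Suc i)) \<or>
    pos_dist N M u v s p q i = Suc (pos_dist N M u v s p q (i - 1))"
proof -
  define a b where "a = end_dist N M u v s p" and "b = end_dist N M v u (M - s) q"
  show ?thesis
  proof (cases "p = u \<and> q = v")
    case True
    then have eq: "pos_dist N M u v s p q j = (if j \<le> s then s - j else j - s)" for j
      by (simp add: pos_dist_def)
    show ?thesis using assms unfolding eq by (auto split: if_splits)
  next
    case False
    then have eq: "pos_dist N M u v s p q j = min (a + j) (b + (M - j))" for j
      unfolding pos_dist_def a_def b_def by (rule if_not_P)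
    obtain k where k: "i = Suc k" using assms(1) by (cases i) auto
    have "M - i = Suc (M - Suc i)" "M - (i - 1) = Suc (M - i)" using assms(1,2) by simp_all
    then show ?thesis unfolding eq k by simp linarith
  qed
qed

lemma end_dist_eq_0: "s \<le> M \<Longrightarrow> 0 < M \<Longrightarrow> end_dist N M u v s p = 0 \<longleftrightarrow> p = u \<and> s = 0"
  by (auto simp: end_dist_def)

lemma pos_dist_eq_0:
  assumes "s \<le> M" "i \<le> M" "0 < M" "pos_dist N M u v s p q i = 0"
  shows "p = u \<and> q = v \<and> i = s \<or> i = 0 \<and> p = u \<and> s = 0 \<or> i = M \<and> q = v \<and> s = M"
proof (cases "p = u \<and> q = v")
  case True
  then show ?thesis using assms(4) by (auto simp: pos_dist_def split: if_splits)
next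
  case False
  then have "min (end_dist N M u v s p + i) (end_dist N M v u (M - s) q + (M - i)) = 0"
    using assms(4) unfolding pos_dist_def by (simp only: if_False)
  then have "end_dist N M u v s p = 0 \<and> i = 0 \<or> end_dist N M v u (M - s) q = 0 \<and> i = M"
    using assms(2) by linarith
  then show ?thesis using assms(1,3) by (auto simp: end_dist_eq_0)
qed

lemma end_dist_descent:
  assumes "u + v < N" "s \<le> M" "0 < M" "p < N" "end_dist N M u v s p \<noteq> 0"
  shows "\<exists>q. p + q < N \<and> end_dist N M u v s p = Suc (pos_dist N M u v s p q 1)"
proof -
  consider "p = u" | "p \<noteq> u" "p + v < N" | "p \<noteq> u" "\<not> p + v < N" by blast
  then show ?thesis
  proof cases
    case 1
    then show ?thesis using assms by (intro exI[of _ v]) (auto simp: end_dist_def pos_dist_def)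
  next
    case 2
    then show ?thesis
      using assms by (intro exI[of _ v]) (auto simp: end_dist_def pos_dist_def min_def)
  next
    case 3
    then have "v \<noteq> 0" using assms(4) by auto
    with 3 show ?thesis
      using assms by (intro exI[of _ 0]) (auto simp: end_dist_def pos_dist_def min_def)
  qed
qed

lemma pos_flip: "i \<le> M \<Longrightarrow> pos N M (\<not> \<sigma>) q p (M - i) = pos N M \<sigma> p q i"
  by (simp add: pos_def)

locale subdivided_half_graph =
  fixes N M :: nat
  assumes N: "0 < N" and M: "0 < M"
begin

abbreviation S :: "nat sub_vertex pair_pre_digraph" where
  "S \<equiv> edge_subdivision M (half_graph N)"

abbreviation spot :: "bool \<Rightarrow> nat \<Rightarrow> nat \<Rightarrow> nat \<Rightarrow> nat sub_vertex" where
  "spot \<equiv> pos N M"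

abbreviation branch :: "bool \<Rightarrow> nat \<Rightarrow> nat sub_vertex" where
  "branch \<sigma> p \<equiv> spot \<sigma> p 0 0"

lemma spot_0: "spot \<sigma> p q 0 = spot \<sigma> p q' 0"
  using M by (simp add: pos_def path_vertex_def)

lemma spot_M: "spot \<sigma> p q M = branch (\<not> \<sigma>) q"
  using M by (simp add: pos_def path_vertex_def)

lemma half_graph_upward_arcs:
  "(u, v) \<in> parcs (half_graph N) \<and> u < v \<longleftrightarrow> (\<exists>q. v = N + q \<and> u + q < N)"
  by (auto simp: half_graph_def node_def)

lemma verts_half_graph: "pverts (half_graph N) = {..<2 * N}"
  by (simp add: half_graph_def)

lemma verts_S: "x \<in> pverts S \<longleftrightarrow> (\<exists>p q i. p + q < N \<and> i \<le> M \<and> x = spot True p q i)"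
proof
  have "x \<in> pverts S \<longleftrightarrow> (\<exists>z < 2 * N. x = Branch z) \<or>
      (\<exists>u v i. ((u, v) \<in> parcs (half_graph N) \<and> u < v) \<and> 0 < i \<and> i < M \<and> x = Inner u v i)"
    by (auto simp: edge_subdivision_def verts_half_graph)
  moreover assume "x \<in> pverts S"
  ultimately consider (branch) z where "z < 2 * N" "x = Branch z"
    | (inner) u q i where "u + q < N" "0 < i" "i < M" "x = Inner u (N + q) i"
    unfolding half_graph_upward_arcs by auto
  then show "\<exists>p q i. p + q < N \<and> i \<le> M \<and> x = spot True p q i"
  proof cases
    case branch
    show ?thesis
    proof (cases "z < N")
      case True
      then show ?thesis using branch by (intro exI[of _ z] exI[of _ 0]) (auto simp: pos_def path_vertex_def)
    next
      case False
      then show ?thesis using branch M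
        by (intro exI[of _ 0] exI[of _ "z - N"] exI[of _ M]) (auto simp: pos_def path_vertex_def)
    qed
  next
    case inner
    then show ?thesis
      by (intro exI[of _ u] exI[of _ q] exI[of _ i]) (auto simp: pos_def path_vertex_def)
  qed
next
  assume "\<exists>p q i. p + q < N \<and> i \<le> M \<and> x = spot True p q i"
  then obtain p q i where "p + q < N" "i \<le> M" "x = spot True p q i" by blast
  moreover from this have "(p, N + q) \<in> parcs (half_graph N) \<and> p < N + q"
    unfolding half_graph_upward_arcs by blast
  moreover have "p \<in> pverts (half_graph N)" "N + q \<in> pverts (half_graph N)"
    using calculation by (auto simp: verts_half_graph)
  ultimately show "x \<in> pverts S"
    by (auto simp: edge_subdivision_def pos_def path_vertex_def)
qed

lemma spot_verts: "p + q < N \<Longrightarrow> i \<le> M \<Longrightarrow> spot \<sigma> p q i \<in> pverts S"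
proof (cases \<sigma>)
  case True
  assume "p + q < N" "i \<le> M"
  with True show ?thesis unfolding verts_S by (intro exI[of _ p] exI[of _ q] exI[of _ i]) simp
next
  case False
  assume "p + q < N" "i \<le> M"
  then have "q + p < N" "M - i \<le> M" "spot \<sigma> p q i = spot True q p (M - i)"
    using False pos_flip[of i M N \<sigma> q p] by auto
  then show ?thesis unfolding verts_S by blast
qed

lemma branch_verts: "p < N \<Longrightarrow> branch \<sigma> p \<in> pverts S"
  by (rule spot_verts) auto

lemma arcs_S:
  "(x, y) \<in> parcs S \<longleftrightarrow> (\<exists>p q i. p + q < N \<and> i < M \<and>
     (x = spot True p q i \<and> y = spot True p q (Suc i) \<or> y = spot True p q i \<and> x = spot True p q (Suc i)))"
proof -
  have "(x, y) \<in> parcs S \<longleftrightarrow> (\<exists>u v i. ((u, v) \<in> parcs (half_graph N) \<and> u < v) \<and> i < M \<and>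
      (x = path_vertex M u v i \<and> y = path_vertex M u v (Suc i) \<or>
       y = path_vertex M u v i \<and> x = path_vertex M u v (Suc i)))"
    unfolding edge_subdivision_def by (auto simp: Let_def)
  then show ?thesis unfolding half_graph_upward_arcs pos_def by auto
qed

lemma spot_arc:
  assumes "p + q < N" "i < M"
  shows "(spot \<sigma> p q i, spot \<sigma> p q (Suc i)) \<in> parcs S" "(spot \<sigma> p q (Suc i), spot \<sigma> p q i) \<in> parcs S"
proof -
  have "\<exists>p' q' i'. p' + q' < N \<and> i' < M \<and>
      (spot \<sigma> p q i = spot True p' q' i' \<and> spot \<sigma> p q (Suc i) = spot True p' q' (Suc i') \<or>
       spot \<sigma> p q (Suc i) = spot True p' q' i' \<and> spot \<sigma> p q i = spot True p' q' (Suc i'))"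
  proof (cases \<sigma>)
    case True
    then show ?thesis using assms by (intro exI[of _ p] exI[of _ q] exI[of _ i]) simp
  next
    case False
    then have "spot \<sigma> p q i = spot True q p (Suc (M - Suc i))" "spot \<sigma> p q (Suc i) = spot True q p (M - Suc i)"
      using assms pos_flip[of i M N True p q] by (auto simp: pos_def Suc_diff_Suc)
    then show ?thesis using assms
      by (intro exI[of _ q] exI[of _ p] exI[of _ "M - Suc i"]) auto
  qed
  then show "(spot \<sigma> p q i, spot \<sigma> p q (Suc i)) \<in> parcs S" "(spot \<sigma> p q (Suc i), spot \<sigma> p q i) \<in> parcs S"
    unfolding arcs_S by blast+
qed

lemma wf_S: "pair_wf_digraph S"
proof
  fix e assume "e \<in> parcs S"
  then have "(fst e, snd e) \<in> parcs S" by simp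
  then show "fst e \<in> pverts S" "snd e \<in> pverts S"
    unfolding arcs_S by (auto intro!: spot_verts)
qed

lemma finite_S: "finite (pverts S)"
proof -
  have "pverts S \<subseteq> (\<lambda>(p, q, i). spot True p q i) ` ({..<N} \<times> {..<N} \<times> {..M})"
  proof
    fix x assume "x \<in> pverts S"
    then obtain p q i where "p + q < N" "i \<le> M" "x = spot True p q i" unfolding verts_S by blast
    then show "x \<in> (\<lambda>(p, q, i). spot True p q i) ` ({..<N} \<times> {..<N} \<times> {..M})"
      by (intro image_eqI[of _ _ "(p, q, i)"]) auto
  qed
  then show ?thesis by (rule finite_subset) simp
qed

lemma dist_S_True:
  assumes uv: "u + v < N" "s \<le> M" and pq: "p + q < N" "i \<le> M"
  shows "graph_dist S (spot True p q i) (spot True u v s) = ereal (real (pos_dist N M u v s p q i))"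
proof -
  \<comment> \<open>The claimed distance as a function of the vertex, whichever path it is regarded to lie on.\<close>
  define f where "f x = (case x of
      Branch z \<Rightarrow> if z < N then end_dist N M u v s z else end_dist N M v u (M - s) (z - N)
    | Inner z z' i \<Rightarrow> pos_dist N M u v s z (z' - N) i)" for x
  have pos_dist_M: "pos_dist N M u v s p q M = end_dist N M v u (M - s) q" if "p + q < N" for p q
    using pos_dist_flip[of s M M N v u q p] pos_dist_start[of v u N q p "M - s" M] uv that
    by (simp add: add.commute)
  have f_True: "f (spot True p q i) = pos_dist N M u v s p q i" if "p + q < N" "i \<le> M" for p q i
    using that uv pos_dist_start[of u v N p q s M] pos_dist_M[of p q] M
    by (auto simp: f_def pos_def path_vertex_def)
  have f_False: "f (spot False q p i) = pos_dist N M v u (M - s) q p i" if "p + q < N" "i \<le> M" for p q i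
    using f_True[of p q "M - i"] pos_flip[of i M N False p q] pos_dist_flip[of s M "M - i" N v u q p]
      that uv by simp
  have "graph_dist S (spot True p q i) (spot True u v s) = ereal (real (f (spot True p q i)))"
  proof (rule graph_dist_eqI[OF wf_S])
    show "spot True u v s \<in> pverts S" "spot True p q i \<in> pverts S" using uv pq by (auto intro: spot_verts)
    show "f (spot True u v s) = 0" using f_True uv by (simp add: pos_dist_def)
    show "f x \<le> Suc (f y)" if "(x, y) \<in> parcs S" for x y
    proof -
      obtain p q i where e: "p + q < N" "i < M"
        "x = spot True p q i \<and> y = spot True p q (Suc i) \<or> y = spot True p q i \<and> x = spot True p q (Suc i)"
        using \<open>(x, y) \<in> _\<close> unfolding arcs_S by blast
      have "f (spot True p q i) = pos_dist N M u v s p q i"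
        "f (spot True p q (Suc i)) = pos_dist N M u v s p q (Suc i)"
        using f_True[OF e(1)] e(2) by simp_all
      then show ?thesis using e(3) pos_dist_step[OF e(2), of N u v s p q] by metis
    qed
    show "x = spot True u v s" if "x \<in> pverts S" "f x = 0" for x
    proof -
      obtain p q i where x: "p + q < N" "i \<le> M" "x = spot True p q i"
        using \<open>x \<in> pverts S\<close> unfolding verts_S by blast
      then have "pos_dist N M u v s p q i = 0" using that f_True by simp
      then consider "p = u" "q = v" "i = s" | "i = 0" "p = u" "s = 0" | "i = M" "q = v" "s = M"
        using pos_dist_eq_0[OF uv(2) x(2) M] by blast
      then show ?thesis using x(3) spot_0[of True] spot_M[of True] by cases auto
    qed
    show "\<exists>y. (x, y) \<in> parcs S \<and> f x = Suc (f y)" if "x \<in> pverts S" "f x \<noteq> 0" for x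
    proof -
      obtain p q i where x: "p + q < N" "i \<le> M" "x = spot True p q i"
        using \<open>x \<in> pverts S\<close> unfolding verts_S by blast
      have up: ?thesis if "i < M" "f x = Suc (f (spot True p q (Suc i)))"
        using spot_arc(1)[OF x(1), of i True] that x(3) by blast
      have down: ?thesis if "i > 0" "f x = Suc (f (spot True p q (i - 1)))"
        using spot_arc(2)[OF x(1), of "i - 1" True] that x(2,3) by (intro exI[of _ "spot True p q (i - 1)"]) simp
      consider "i = 0" | "i = M" | "0 < i" "i < M" using x(2) by linarith
      then show ?thesis
      proof cases
        case 1
        then have "f x = end_dist N M u v s p" using f_True x pos_dist_start[OF uv(1) x(1) uv(2)] by simp
        then obtain r where r: "p + r < N" "f x = Suc (pos_dist N M u v s p r 1)"
          using end_dist_descent[OF uv M, of p] \<open>f x \<noteq> 0\<close> x(1) by auto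
        have "x = spot True p r 0" using spot_0[of True p q r] x(3) 1 by simp
        then show ?thesis using spot_arc(1)[OF r(1) M, of True] f_True[OF r(1), of 1] r(2) M by auto
      next
        case 2
        then have "f x = end_dist N M v u (M - s) q" using f_True x pos_dist_M by simp
        then obtain r where r: "q + r < N" "f x = Suc (pos_dist N M v u (M - s) q r 1)"
          using end_dist_descent[of v u N "M - s" M q] \<open>f x \<noteq> 0\<close> x(1) uv M by (auto simp: add.commute)
        have "x = spot False q r 0" using spot_0[of False q 0 r] spot_M[of True p q] x(3) 2 by simp
        then show ?thesis
          using spot_arc(1)[OF r(1) M, of False] f_False[of r q 1] r M by (auto simp: add.commute)
      next
        case 3
        then have "pos_dist N M u v s p q i = Suc (pos_dist N M u v s p q (Suc i)) \<or>
            pos_dist N M u v s p q i = Suc (pos_dist N M u v s p q (i - 1))"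
          using \<open>f x \<noteq> 0\<close> f_True[OF x(1,2)] x(3) by (intro pos_dist_descent) auto
        then show ?thesis using up down 3 f_True x by auto
      qed
    qed
  qed
  then show ?thesis using f_True pq by simp
qed

lemma dist_S:
  assumes "u + v < N" "s \<le> M" "p + q < N" "i \<le> M"
  shows "graph_dist S (spot \<sigma> p q i) (spot \<sigma> u v s) = ereal (real (pos_dist N M u v s p q i))"
proof (cases \<sigma>)
  case True
  then show ?thesis using dist_S_True assms by simp
next
  case False
  then show ?thesis
    using dist_S_True[of v u "M - s" q p "M - i"] assms
    by (simp add: pos_flip[symmetric, of _ M N False] pos_dist_flip add.commute)
qed

end

context subdivided_half_graph
begin

section \<open>Locating the robber in long subdivisions\<close>

lemma spot_eq_iff_full:
  assumes "p + q < N" "p' + q' < N" "i \<le> M" "i' \<le> M"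
  shows "spot \<sigma> p q i = spot \<sigma> p' q' i' \<longleftrightarrow> i = i' \<and> (p = p' \<or> i = M) \<and> (q = q' \<or> i = 0)"
proof -
  have True_side: "spot True p q i = spot True p' q' i' \<longleftrightarrow> i = i' \<and> (p = p' \<or> i = M) \<and> (q = q' \<or> i = 0)"
    if "p + q < N" "p' + q' < N" "i \<le> M" "i' \<le> M" for p q i p' q' i'
  proof -
    have "p < N" "p' < N" using that by simp_all
    then show ?thesis using M unfolding pos_def path_vertex_def
      by (cases "i = 0"; cases "i = M"; cases "i' = 0"; cases "i' = M"; simp; blast?)
  qed
  show ?thesis
  proof (cases \<sigma>)
    case True
    then show ?thesis using True_side[OF assms] by simp
  next
    case False
    have "spot \<sigma> p q i = spot True q p (M - i)" "spot \<sigma> p' q' i' = spot True q' p' (M - i')"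
      using False by (simp_all add: pos_def)
    moreover have "M - i = M - i' \<longleftrightarrow> i = i'" "M - i = M \<longleftrightarrow> i = 0" "M - i = 0 \<longleftrightarrow> i = M"
      using assms(3,4) M by auto
    ultimately show ?thesis
      using True_side[of q p q' p' "M - i" "M - i'"] assms(1,2) by (auto simp: add.commute)
  qed
qed

lemma arcs_S_side:
  assumes "(x, y) \<in> parcs S"
  shows "\<exists>p q i. p + q < N \<and> i < M \<and> (x = spot \<sigma> p q i \<and> y = spot \<sigma> p q (Suc i) \<or>
    y = spot \<sigma> p q i \<and> x = spot \<sigma> p q (Suc i))"
proof -
  obtain p q i where pqi: "p + q < N" "i < M" "x = spot True p q i \<and> y = spot True p q (Suc i) \<or>
      y = spot True p q i \<and> x = spot True p q (Suc i)"
    using assms unfolding arcs_S by blast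
  show ?thesis
  proof (cases \<sigma>)
    case True
    then show ?thesis using pqi by (intro exI[of _ p] exI[of _ q] exI[of _ i]) simp
  next
    case False
    have "spot True p q i = spot False q p (Suc (M - Suc i))"
      "spot True p q (Suc i) = spot False q p (M - Suc i)"
      using pqi(2) pos_flip[of i M N True q p] pos_flip[of "Suc i" M N True q p]
      by (simp_all add: Suc_diff_Suc)
    then show ?thesis using pqi False
      by (intro exI[of _ q] exI[of _ p] exI[of _ "M - Suc i"]) auto
  qed
qed

lemma spot_neighbours:
  assumes "p + q < N" "i \<le> M" "(spot \<sigma> p q i, y) \<in> parcs S"
  shows "\<exists>p' q' i'. p' + q' < N \<and> i' \<le> M \<and> y = spot \<sigma> p' q' i' \<and> (i' = Suc i \<or> i = Suc i') \<and>
    (p' = p \<or> i = M) \<and> (q' = q \<or> i = 0)"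
proof -
  obtain p' q' j where j: "p' + q' < N" "j < M"
    "spot \<sigma> p q i = spot \<sigma> p' q' j \<and> y = spot \<sigma> p' q' (Suc j) \<or>
      y = spot \<sigma> p' q' j \<and> spot \<sigma> p q i = spot \<sigma> p' q' (Suc j)"
    using arcs_S_side[OF assms(3), of \<sigma>] by blast
  from j(3) show ?thesis
  proof
    assume *: "spot \<sigma> p q i = spot \<sigma> p' q' j \<and> y = spot \<sigma> p' q' (Suc j)"
    then have "i = j \<and> (p = p' \<or> i = M) \<and> (q = q' \<or> i = 0)"
      using spot_eq_iff_full[OF assms(1) j(1) assms(2) less_imp_le[OF j(2)]] by blast
    then show ?thesis using * j(1,2)
      by (intro exI[of _ p'] exI[of _ q'] exI[of _ "Suc j"] conjI) auto
  next
    assume *: "y = spot \<sigma> p' q' j \<and> spot \<sigma> p q i = spot \<sigma> p' q' (Suc j)"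
    then have "i = Suc j \<and> (p = p' \<or> i = M) \<and> (q = q' \<or> i = 0)"
      using spot_eq_iff_full[OF assms(1) j(1) assms(2) Suc_leI[OF j(2)]] by blast
    then show ?thesis using * j(1,2)
      by (intro exI[of _ p'] exI[of _ q'] exI[of _ j] conjI) auto
  qed
qed

abbreviation win :: "nat sub_vertex set \<Rightarrow> bool" where
  "win \<equiv> cop_wins 1 S"

definition branches :: "bool \<Rightarrow> nat set \<Rightarrow> nat sub_vertex set" where
  "branches \<sigma> H = branch \<sigma> ` H"

definition between :: "bool \<Rightarrow> nat set \<Rightarrow> nat set \<Rightarrow> nat \<Rightarrow> nat sub_vertex set" where
  "between \<sigma> H X i = {spot \<sigma> p q i |p q. p \<in> H \<and> q \<in> X \<and> p + q < N}"

lemma branches_mono: "H' \<subseteq> H \<Longrightarrow> branches \<sigma> H' \<subseteq> branches \<sigma> H"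
  by (auto simp: branches_def)

lemma between_mono: "H' \<subseteq> H \<Longrightarrow> X' \<subseteq> X \<Longrightarrow> between \<sigma> H' X' i \<subseteq> between \<sigma> H X i"
  by (auto simp: between_def)

lemma between_flip: "i \<le> M \<Longrightarrow> between (\<not> \<sigma>) X H (M - i) = between \<sigma> H X i"
proof -
  assume "i \<le> M"
  then have flip: "spot (\<not> \<sigma>) q p (M - i) = spot \<sigma> p q i" for p q by (rule pos_flip)
  show ?thesis unfolding between_def flip by (intro set_eqI iffI; clarsimp; metis add.commute)
qed

lemma spot_0_in_branches: "p \<in> H \<Longrightarrow> spot \<sigma> p q 0 \<in> branches \<sigma> H"
  unfolding branches_def using spot_0[of \<sigma> p q 0] by blast

lemma spot_M_in_branches: "q \<in> X \<Longrightarrow> spot \<sigma> p q M \<in> branches (\<not> \<sigma>) X"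
  unfolding branches_def using spot_M[of \<sigma> p q] by blast

lemma nbhd_between:
  assumes "v \<in> closed_nbhd S (between \<sigma> H X i)" "0 < i" "i < M"
  shows "\<exists>p q i'. v = spot \<sigma> p q i' \<and> p \<in> H \<and> q \<in> X \<and> p + q < N \<and> i' \<le> M \<and> i' \<le> Suc i"
proof -
  obtain p q where pq: "p \<in> H" "q \<in> X" "p + q < N"
    "v = spot \<sigma> p q i \<or> (spot \<sigma> p q i, v) \<in> parcs S"
    using assms(1) by (auto simp: closed_nbhd_def between_def)
  show ?thesis
  proof (cases "v = spot \<sigma> p q i")
    case True
    then show ?thesis using pq assms by (intro exI[of _ p] exI[of _ q] exI[of _ i]) auto
  next
    case False
    then have "(spot \<sigma> p q i, v) \<in> parcs S" using pq(4) by blast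
    from spot_neighbours[OF pq(3) _ this] assms obtain i' where "i' \<le> M" "v = spot \<sigma> p q i'"
      "i' = Suc i \<or> i = Suc i'" by auto
    then show ?thesis using pq by (intro exI[of _ p] exI[of _ q] exI[of _ i']) auto
  qed
qed

lemma nbhd_branches:
  assumes "v \<in> closed_nbhd S (branches \<sigma> H)" "H \<subseteq> {..<N}"
  shows "\<exists>p q i'. v = spot \<sigma> p q i' \<and> p \<in> H \<and> p + q < N \<and> i' \<le> 1"
proof -
  obtain p where p: "p \<in> H" "v = branch \<sigma> p \<or> (branch \<sigma> p, v) \<in> parcs S"
    using assms(1) by (auto simp: closed_nbhd_def branches_def)
  then have "p + 0 < N" using assms(2) by auto
  show ?thesis
  proof (cases "v = branch \<sigma> p")
    case True
    then show ?thesis using p \<open>p + 0 < N\<close> by (intro exI[of _ p] exI[of _ 0] exI[of _ 0]) auto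
  next
    case False
    then have "(branch \<sigma> p, v) \<in> parcs S" using p(2) by blast
    from spot_neighbours[OF \<open>p + 0 < N\<close> _ this] M obtain q' where "p + q' < N" "v = spot \<sigma> p q' 1"
      by auto
    then show ?thesis using p by (intro exI[of _ p] exI[of _ q'] exI[of _ 1]) auto
  qed
qed

lemma dist_branch_opposite:
  assumes "p + q < N" "i \<le> M" "u < N"
  shows "graph_dist S (spot \<sigma> p q i) (branch (\<not> \<sigma>) u) =
    ereal (real (if u = q then M - i else if u + p < N then M + i else 3 * M - i))"
proof -
  have "graph_dist S (spot \<sigma> p q i) (branch (\<not> \<sigma>) u) =
      ereal (real (pos_dist N M u 0 0 q p (M - i)))"
    using dist_S[of u 0 0 q p "M - i" "\<not> \<sigma>"] assms by (simp add: pos_flip add.commute)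
  also have "pos_dist N M u 0 0 q p (M - i) =
      (if u = q then M - i else if u + p < N then M + i else 3 * M - i)"
    using assms by (simp add: pos_dist_def end_dist_def add.commute)
  finally show ?thesis .
qed

text \<open>
  What a probe of a branch vertex reveals. The answer lies in one of the ranges from \<open>0\<close> to \<open>M\<close>, from
  \<open>M\<close> to \<open>2 M\<close>, and from \<open>2 M\<close> to \<open>3 M\<close>, and within its range it determines the place \<open>i\<close> on the path.
  The range tells on which side of the threshold the end \<open>p\<close> opposite to the probe lies, and whether
  the other end is the probed vertex. At the ends of the path two ranges meet, and the vertex at the
  distant end no longer matters.
\<close>

lemma win_by_opposite_probe:
  assumes u: "u < N"
    and T: "\<And>v. v \<in> closed_nbhd S T \<Longrightarrow> \<exists>p q i. v = spot \<sigma> p q i \<and> P p q i"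
    and P: "\<And>p q i. P p q i \<Longrightarrow> p + q < N \<and> i \<le> M"
    and cases: "\<And>p q i. P p q i \<Longrightarrow> \<exists>T'. win T' \<and> (\<forall>p' q'. P p' q' i \<and>
      (i < M \<longrightarrow> (u + p' < N \<longleftrightarrow> u + p < N)) \<and> (0 < i \<longrightarrow> (u = q' \<longleftrightarrow> u = q)) \<longrightarrow> spot \<sigma> p' q' i \<in> T')"
  shows "win T"
proof (rule cop_wins_probeI[where us = "[branch (\<not> \<sigma>) u]"])
  show "set [branch (\<not> \<sigma>) u] \<subseteq> pverts S" using u by (simp add: branch_verts)
next
  fix v assume "v \<in> closed_nbhd S T"
  then obtain p q i where v: "v = spot \<sigma> p q i" "P p q i" using T by blast
  obtain T' where T': "win T'" "\<And>p' q'. P p' q' i \<Longrightarrow> (i < M \<longrightarrow> (u + p' < N \<longleftrightarrow> u + p < N)) \<Longrightarrow>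
      (0 < i \<longrightarrow> (u = q' \<longleftrightarrow> u = q)) \<Longrightarrow> spot \<sigma> p' q' i \<in> T'"
    using cases[OF v(2)] by blast
  have "v' \<in> T'" if "v' \<in> closed_nbhd S T"
    "replies S [branch (\<not> \<sigma>) u] v' = replies S [branch (\<not> \<sigma>) u] v" for v'
  proof -
    obtain p' q' i' where v': "v' = spot \<sigma> p' q' i'" "P p' q' i'" using T \<open>v' \<in> _\<close> by blast
    have "(if u = q' then M - i' else if u + p' < N then M + i' else 3 * M - i') =
        (if u = q then M - i else if u + p < N then M + i else 3 * M - i)"
      using that(2) P[OF v(2)] P[OF v'(2)] u
      by (simp add: replies_def v(1) v'(1) dist_branch_opposite)
    then have "i' = i \<and> (i < M \<longrightarrow> (u + p' < N \<longleftrightarrow> u + p < N)) \<and> (0 < i \<longrightarrow> (u = q' \<longleftrightarrow> u = q))"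
      using P[OF v(2)] P[OF v'(2)] M by (auto split: if_splits)
    then show ?thesis using T'(2)[of p' q'] v' by auto
  qed
  then show "\<exists>T'. win T' \<and> (\<forall>v'\<in>closed_nbhd S T.
      replies S [branch (\<not> \<sigma>) u] v' = replies S [branch (\<not> \<sigma>) u] v \<longrightarrow> v' \<in> T')"
    using T'(1) by blast
qed simp

lemma win_by_same_side_probe:
  assumes u: "u < N"
    and T: "\<And>v. v \<in> closed_nbhd S T \<Longrightarrow> \<exists>p q i. v = spot \<sigma> p q i \<and> P p q i"
    and P: "\<And>p q i. P p q i \<Longrightarrow> p + q < N \<and> i \<le> M"
    and cases: "\<And>p q i. P p q i \<Longrightarrow> \<exists>T'. win T' \<and> (\<forall>p' q'. P p' q' i \<and>
      (0 < i \<longrightarrow> (u + q' < N \<longleftrightarrow> u + q < N)) \<and> (i < M \<longrightarrow> (u = p' \<longleftrightarrow> u = p)) \<longrightarrow> spot \<sigma> p' q' i \<in> T')"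
  shows "win T"
proof (rule win_by_opposite_probe[where \<sigma> = "\<not> \<sigma>" and u = u and
      P = "\<lambda>q p i. i \<le> M \<and> P p q (M - i)", OF u])
  show "\<exists>q p i. v = spot (\<not> \<sigma>) q p i \<and> i \<le> M \<and> P p q (M - i)" if "v \<in> closed_nbhd S T" for v
  proof -
    obtain p q i where "v = spot \<sigma> p q i" "P p q i" using T[OF \<open>v \<in> _\<close>] by blast
    moreover from this have "i \<le> M" using P by blast
    ultimately show ?thesis using pos_flip[of i M N \<sigma> q p]
      by (intro exI[of _ q] exI[of _ p] exI[of _ "M - i"]) simp
  qed
  show "q + p < N \<and> i \<le> M" if "i \<le> M \<and> P p q (M - i)" for q p i
    using P[of p q "M - i"] that by (simp add: add.commute)
  show "\<exists>T'. win T' \<and> (\<forall>q' p'. (i \<le> M \<and> P p' q' (M - i)) \<and>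
      (i < M \<longrightarrow> (u + q' < N \<longleftrightarrow> u + q < N)) \<and> (0 < i \<longrightarrow> (u = p' \<longleftrightarrow> u = p)) \<longrightarrow>
      spot (\<not> \<sigma>) q' p' i \<in> T')" if i: "i \<le> M \<and> P p q (M - i)" for q p i
  proof -
    obtain T' where T': "win T'" "\<And>p' q'. P p' q' (M - i) \<Longrightarrow>
        (0 < M - i \<longrightarrow> (u + q' < N \<longleftrightarrow> u + q < N)) \<Longrightarrow> (M - i < M \<longrightarrow> (u = p' \<longleftrightarrow> u = p)) \<Longrightarrow>
        spot \<sigma> p' q' (M - i) \<in> T'"
      using cases[of p q "M - i"] i by blast
    have "spot (\<not> \<sigma>) q' p' i \<in> T'" if "P p' q' (M - i)" "i < M \<longrightarrow> (u + q' < N \<longleftrightarrow> u + q < N)"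
      "0 < i \<longrightarrow> (u = p' \<longleftrightarrow> u = p)" for p' q'
      using T'(2)[of p' q'] that i pos_flip[of "M - i" M N \<sigma> q' p'] by auto
    then show ?thesis using T'(1) by blast
  qed
qed

lemma threshold_split:
  assumes "x \<in> H" "y \<in> H" "x < y" "y < N"
  shows "{p' \<in> H. N - y + p' < N \<longleftrightarrow> N - y + p < N} \<subset> H"
proof -
  have "N - y + p' < N \<longleftrightarrow> p' < y" for p' using assms(4) by arith
  then show ?thesis using assms(1-3) by (cases "p < y") auto
qed

lemma win_branches_singleton:
  assumes "\<And>p p'. p \<in> H \<Longrightarrow> p' \<in> H \<Longrightarrow> p = p'"
  shows "win (branches \<sigma> H)"
proof (rule cop_wins.located)
  fix x y assume "x \<in> branches \<sigma> H" "y \<in> branches \<sigma> H"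
  then obtain p p' where "p \<in> H" "p' \<in> H" "x = branch \<sigma> p" "y = branch \<sigma> p'"
    by (auto simp: branches_def)
  then show "x = y" using assms[of p p'] by simp
qed

lemma win_between_split:
  assumes H: "H \<subseteq> {..<N}" "x \<in> H" "y \<in> H" "x < y" and i: "0 < i" "i < M"
    and home: "win (branches \<sigma> H)" and far: "win (branches (\<not> \<sigma>) X)"
    and smaller: "\<And>H' i'. H' \<subset> H \<Longrightarrow> 0 < i' \<Longrightarrow> i' < M \<Longrightarrow> win (between \<sigma> H' X i')"
  shows "win (between \<sigma> H X i)"
proof (rule win_by_opposite_probe[where u = "N - y" and \<sigma> = \<sigma> and
      P = "\<lambda>p q i'. p \<in> H \<and> q \<in> X \<and> p + q < N \<and> i' \<le> M"])
  show "N - y < N" using H(4) N by simp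
  show "\<exists>p q i. v = spot \<sigma> p q i \<and> p \<in> H \<and> q \<in> X \<and> p + q < N \<and> i \<le> M"
    if "v \<in> closed_nbhd S (between \<sigma> H X i)" for v
    using nbhd_between[OF that i] by blast
next
  fix p q i' assume P: "p \<in> H \<and> q \<in> X \<and> p + q < N \<and> i' \<le> M"
  have "y < N" using H by auto
  define H' where "H' = {p' \<in> H. N - y + p' < N \<longleftrightarrow> N - y + p < N}"
  have "H' \<subset> H" unfolding H'_def using H(2-4) \<open>y < N\<close> by (rule threshold_split)
  consider "i' = 0" | "i' = M" | "0 < i'" "i' < M" using P by linarith
  then show "\<exists>T'. win T' \<and> (\<forall>p' q'. (p' \<in> H \<and> q' \<in> X \<and> p' + q' < N \<and> i' \<le> M) \<and>
      (i' < M \<longrightarrow> (N - y + p' < N \<longleftrightarrow> N - y + p < N)) \<and> (0 < i' \<longrightarrow> (N - y = q' \<longleftrightarrow> N - y = q)) \<longrightarrow>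
      spot \<sigma> p' q' i' \<in> T')"
  proof cases
    case 1
    then show ?thesis using home spot_0_in_branches by blast
  next
    case 2
    then show ?thesis using far spot_M_in_branches by blast
  next
    case 3
    then have "win (between \<sigma> H' X i')" using smaller \<open>H' \<subset> H\<close> by blast
    moreover have "spot \<sigma> p' q' i' \<in> between \<sigma> H' X i'"
      if "p' \<in> H" "q' \<in> X" "p' + q' < N" "N - y + p' < N \<longleftrightarrow> N - y + p < N" for p' q'
      using that by (auto simp: between_def H'_def)
    ultimately show ?thesis using 3 by blast
  qed
qed simp

text \<open>
  While the robber stays inside a path, its ends do not change, and threshold probes locate both of
  them. He can only interrupt this by reaching an end, from where the cop wins by assumption.
\<close>

lemma win_between:
  assumes "H \<subseteq> {..<N}" "X \<subseteq> {..<N}" "0 < i" "i < M"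
    and "win (branches \<sigma> H)" "win (branches (\<not> \<sigma>) X)"
  shows "win (between \<sigma> H X i)"
  using assms
proof (induction "card H + card X" arbitrary: \<sigma> H X i rule: less_induct)
  case less
  have fin: "finite H" "finite X" using less.prems(1,2) by (auto intro: finite_subset)
  have smaller: "win (between \<sigma> H' X i')" if "H' \<subset> H" "0 < i'" "i' < M" for H' i'
    using that less.prems fin psubset_card_mono[OF fin(1) that(1)]
      cop_wins_mono[OF less.prems(5) branches_mono[of H' H]]
    by (intro less.hyps) auto
  have smaller': "win (between (\<not> \<sigma>) X' H i')" if "X' \<subset> X" "0 < i'" "i' < M" for X' i'
    using that less.prems fin psubset_card_mono[OF fin(2) that(1)]
      cop_wins_mono[OF less.prems(6) branches_mono[of X' X]]
    by (intro less.hyps) auto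
  show ?case
  proof (cases "\<exists>x \<in> H. \<exists>y \<in> H. x < y")
    case True
    then show ?thesis using win_between_split[OF less.prems(1)] less.prems smaller by blast
  next
    case no_H: False
    show ?thesis
    proof (cases "\<exists>x \<in> X. \<exists>y \<in> X. x < y")
      case True
      then obtain x y where "x \<in> X" "y \<in> X" "x < y" by blast
      then have "win (between (\<not> \<sigma>) X H (M - i))"
        using win_between_split[OF less.prems(2), of x y "M - i" "\<not> \<sigma>" H] less.prems smaller' by auto
      then show ?thesis using between_flip[of i \<sigma> X H] less.prems(4) by simp
    next
      case False
      show ?thesis
      proof (rule cop_wins.located)
        fix x y assume "x \<in> between \<sigma> H X i" "y \<in> between \<sigma> H X i"
        then obtain p q p' q' where xy: "p \<in> H" "q \<in> X" "p' \<in> H" "q' \<in> X"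
          "x = spot \<sigma> p q i" "y = spot \<sigma> p' q' i" by (auto simp: between_def)
        then have "p = p'" "q = q'" using no_H False by (meson nat_neq_iff)+
        then show "x = y" using xy by simp
      qed
    qed
  qed
qed

end

text \<open>
  A robber who crosses a path of length \<open>M\<close> is probed \<open>M\<close> times on the way: once for the end that he
  leaves and \<open>b\<close> times for a binary search among \<open>2 ^ b\<close> ranks at the other end.
\<close>

locale long_subdivided_half_graph = subdivided_half_graph +
  fixes h b :: nat
  assumes N_eq: "N = 2 * h" and h_eq: "h = 2 ^ b" and M_ge: "Suc b \<le> M" "2 \<le> M"
begin

text \<open>
  Binary search on the way to the far end distinguishes the ranks \<open>min q (h - 1)\<close>, so the nodes from
  \<open>h - 1\<close> on are lumped together.
\<close>

definition outer :: "nat set" where "outer = {h - 1..<N}"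

lemma h_pos: "0 < h" by (simp add: h_eq)

lemma win_branches_rank:
  assumes "win (branches \<tau> (Y \<inter> outer))" "Y \<subseteq> {..<N}"
  shows "win (branches \<tau> {q \<in> Y. l \<le> min q (h - 1) \<and> min q (h - 1) < Suc l})"
proof (cases "l < h - 1")
  case True
  then have "q = l" if "l \<le> min q (h - 1) \<and> min q (h - 1) < Suc l" for q using that by linarith
  then show ?thesis by (intro win_branches_singleton) blast
next
  case False
  then have "{q \<in> Y. l \<le> min q (h - 1) \<and> min q (h - 1) < Suc l} \<subseteq> Y \<inter> outer"
    using assms(2) by (auto simp: outer_def)
  then show ?thesis using assms(1) branches_mono cop_wins_mono by meson
qed

text \<open>
  The binary search: with \<open>2 ^ r\<close> ranks left at place \<open>i\<close>, the \<open>r\<close> remaining probes are made before the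
  robber is beyond place \<open>i + r \<le> M\<close>. If he turns back to where he came from, the search is lost, but
  the candidates \<open>H\<close> for that end have not become more numerous.
\<close>

lemma win_chase:
  assumes H: "H \<subseteq> {..<N}" "win (branches \<sigma> H)"
    and Y: "Y \<subseteq> {..<N}" "win (branches (\<not> \<sigma>) (Y \<inter> outer))"
    and i: "0 < i" "i < M" "r + i \<le> M"
  shows "win (between \<sigma> H {q \<in> Y. l \<le> min q (h - 1) \<and> min q (h - 1) < l + 2 ^ r} i)"
  using i
proof (induction r arbitrary: i l)
  case 0
  have "win (branches (\<not> \<sigma>) {q \<in> Y. l \<le> min q (h - 1) \<and> min q (h - 1) < l + 2 ^ 0})"
    using win_branches_rank[OF Y(2,1), of l] by simp
  moreover have "{q \<in> Y. l \<le> min q (h - 1) \<and> min q (h - 1) < l + 2 ^ 0} \<subseteq> {..<N}"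
    using Y(1) by blast
  ultimately show ?case using H 0 by (intro win_between)
next
  case (Suc r)
  define X where "X l r = {q \<in> Y. l \<le> min q (h - 1) \<and> min q (h - 1) < l + 2 ^ r}" for l and r :: nat
  define t where "t = l + 2 ^ r"
  have IH: "win (between \<sigma> H (X l' r) i')" if "0 < i'" "i' < M" "r + i' \<le> M" for l' i'
    unfolding X_def by (rule Suc.IH[OF that])
  have "win (between \<sigma> H (X l (Suc r)) i)"
  proof (cases "t < h")
    case False
    then have "min q (h - 1) < l + 2 ^ r" for q using h_pos unfolding t_def by linarith
    then have "X l (Suc r) \<subseteq> X l r" unfolding X_def by blast
    moreover have "win (between \<sigma> H (X l r) i)" using Suc.prems by (intro IH) simp_all
    ultimately show ?thesis using cop_wins_mono[OF _ between_mono[OF order_refl]] by simp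
  next
    case True
    have t: "0 < t" "N - t < N" using N by (simp_all add: t_def)
    have test: "N - t + q < N \<longleftrightarrow> min q (h - 1) < t" for q using True N_eq by linarith
    show ?thesis
    proof (rule win_by_same_side_probe[where u = "N - t" and \<sigma> = \<sigma> and
          P = "\<lambda>p q i'. p \<in> H \<and> q \<in> X l (Suc r) \<and> p + q < N \<and> i' \<le> M \<and> i' \<le> Suc i", OF t(2)])
      show "\<exists>p q i'. v = spot \<sigma> p q i' \<and> p \<in> H \<and> q \<in> X l (Suc r) \<and> p + q < N \<and> i' \<le> M \<and> i' \<le> Suc i"
        if "v \<in> closed_nbhd S (between \<sigma> H (X l (Suc r)) i)" for v
        using nbhd_between[OF that Suc.prems(1,2)] by blast
    next
      fix p q i' assume P: "p \<in> H \<and> q \<in> X l (Suc r) \<and> p + q < N \<and> i' \<le> M \<and> i' \<le> Suc i"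
      define l' where "l' = (if N - t + q < N then l else t)"
      have X': "q' \<in> X l' r" if "q' \<in> X l (Suc r)" "N - t + q' < N \<longleftrightarrow> N - t + q < N" for q'
      proof (cases "min q (h - 1) < t")
        case True
        then have "l' = l" "min q' (h - 1) < t" using that(2) test by (simp_all add: l'_def)
        then show ?thesis using that(1) unfolding X_def t_def by blast
      next
        case False
        then have "l' = t" unfolding l'_def test by (rule if_not_P)
        moreover have "t \<le> min q' (h - 1)" using that(2) False unfolding test by linarith
        moreover have "l + 2 ^ Suc r = t + 2 ^ r" by (simp add: t_def)
        ultimately show ?thesis using that(1) unfolding X_def by simp
      qed
      consider "i' = 0" | "i' = M" | "0 < i'" "i' < M" using P by linarith
      then show "\<exists>T'. win T' \<and> (\<forall>p' q'. (p' \<in> H \<and> q' \<in> X l (Suc r) \<and> p' + q' < N \<and> i' \<le> M \<and> i' \<le> Suc i) \<and>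
        (0 < i' \<longrightarrow> (N - t + q' < N \<longleftrightarrow> N - t + q < N)) \<and> (i' < M \<longrightarrow> (N - t = p' \<longleftrightarrow> N - t = p)) \<longrightarrow>
        spot \<sigma> p' q' i' \<in> T')"
      proof cases
        case 1
        then show ?thesis using H(2) spot_0_in_branches by blast
      next
        case 2
        then have "r = 0" using P Suc.prems by linarith
        then have "win (branches (\<not> \<sigma>) (X l' r))"
          using win_branches_rank[OF Y(2,1), of l'] by (simp add: X_def)
        moreover have "spot \<sigma> p' q' i' \<in> branches (\<not> \<sigma>) (X l' r)" if "q' \<in> X l' r" for p' q'
          using spot_M_in_branches[OF that] 2 by simp
        moreover have "0 < i'" using 2 M by simp
        ultimately show ?thesis using X' by blast
      next
        case 3
        then have "win (between \<sigma> H (X l' r) i')" using P Suc.prems by (intro IH) simp_all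
        moreover have "spot \<sigma> p' q' i' \<in> between \<sigma> H (X l' r) i'"
          if "p' \<in> H" "q' \<in> X l' r" "p' + q' < N" for p' q'
          using that unfolding between_def by blast
        ultimately show ?thesis using X' 3 by blast
      qed
    qed blast
  qed
  then show ?case unfolding X_def .
qed

lemma win_departed:
  assumes H: "H \<subseteq> {..<N}" "win (branches \<sigma> H)"
    and Y: "Y \<subseteq> {..<N}" "win (branches (\<not> \<sigma>) (Y \<inter> outer))"
  shows "win (between \<sigma> H Y 1)"
proof -
  have "min q (h - 1) < 0 + 2 ^ b" for q using h_pos unfolding h_eq[symmetric] by linarith
  then have "Y = {q \<in> Y. 0 \<le> min q (h - 1) \<and> min q (h - 1) < 0 + 2 ^ b}" by simp
  then show ?thesis using win_chase[OF H Y, of 1 b 0] M_ge by simp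
qed

text \<open>
  Whether or not the robber leaves his end, the probe made meanwhile splits the set \<open>H\<close> of its candidates.
  So he can be back at the same end only finitely often, and he reaches the other end located or in
  \<open>outer\<close>, from where the cop wins by assumption.
\<close>

lemma win_branches:
  assumes "H \<subseteq> {..<N}" and Y: "Y \<subseteq> {..<N}" "win (branches (\<not> \<sigma>) (Y \<inter> outer))"
    and "\<And>p q. p \<in> H \<Longrightarrow> p + q < N \<Longrightarrow> q \<in> Y"
  shows "win (branches \<sigma> H)"
  using assms(1,4)
proof (induction "card H" arbitrary: H rule: less_induct)
  case less
  have fin: "finite H" using less.prems(1) by (auto intro: finite_subset)
  show ?case
  proof (cases "\<exists>x \<in> H. \<exists>y \<in> H. x < y")
    case False
    then show ?thesis by (intro win_branches_singleton) (meson nat_neq_iff)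
  next
    case True
    then obtain x y where xy: "x \<in> H" "y \<in> H" "x < y" by blast
    then have "y < N" using less.prems(1) by auto
    \<comment> \<open>The node \<open>N - y\<close> of the other side is adjacent to exactly the nodes below \<open>y\<close>.\<close>
    show ?thesis
    proof (rule win_by_opposite_probe[where u = "N - y" and \<sigma> = \<sigma> and
          P = "\<lambda>p q i'. p \<in> H \<and> p + q < N \<and> i' \<le> 1"])
      show "N - y < N" using xy N by simp
      show "\<exists>p q i. v = spot \<sigma> p q i \<and> p \<in> H \<and> p + q < N \<and> i \<le> 1"
        if "v \<in> closed_nbhd S (branches \<sigma> H)" for v
        using nbhd_branches[OF that less.prems(1)] by blast
      show "p + q < N \<and> i' \<le> M" if "p \<in> H \<and> p + q < N \<and> i' \<le> 1" for p q i' using that M by auto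
    next
      fix p q i' assume P: "p \<in> H \<and> p + q < N \<and> i' \<le> (1 :: nat)"
      define H' where "H' = {p' \<in> H. N - y + p' < N \<longleftrightarrow> N - y + p < N}"
      have "H' \<subset> H" unfolding H'_def using xy \<open>y < N\<close> by (rule threshold_split)
      then have H': "H' \<subseteq> {..<N}" "win (branches \<sigma> H')"
        using less.hyps[OF psubset_card_mono[OF fin \<open>H' \<subset> H\<close>]] less.prems by (auto simp: H'_def)
      consider "i' = 0" | "i' = 1" using P by linarith
      then show "\<exists>T'. win T' \<and> (\<forall>p' q'. (p' \<in> H \<and> p' + q' < N \<and> i' \<le> 1) \<and>
          (i' < M \<longrightarrow> (N - y + p' < N \<longleftrightarrow> N - y + p < N)) \<and> (0 < i' \<longrightarrow> (N - y = q' \<longleftrightarrow> N - y = q)) \<longrightarrow>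
          spot \<sigma> p' q' i' \<in> T')"
      proof cases
        case 1
        then show ?thesis using H'(2) spot_0_in_branches[of _ H'] M unfolding H'_def by blast
      next
        case 2
        have "win (between \<sigma> H' Y 1)" using H' Y by (rule win_departed)
        moreover have "spot \<sigma> p' q' 1 \<in> between \<sigma> H' Y 1"
          if "p' \<in> H" "p' + q' < N" "N - y + p' < N \<longleftrightarrow> N - y + p < N" for p' q'
          using that less.prems(2)[of p' q'] unfolding between_def H'_def by blast
        moreover have "i' < M" using 2 M_ge by simp
        ultimately show ?thesis using 2 by blast
      qed
    qed
  qed
qed

text \<open>
  From the node \<open>h\<close> or a larger one only the ranks of the nodes up to \<open>h - 1\<close> can be reached, each of
  which is a single node; from \<open>h - 1\<close> also the node \<open>h\<close>. The probe at \<open>h\<close> on the other side tells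
  \<open>h - 1\<close> from the larger nodes, as \<open>h\<close> is not adjacent to \<open>h\<close>, and at the same time tells whether the
  robber is heading for \<open>h\<close>.
\<close>

lemma win_outer: "win (branches \<sigma> outer)"
proof (rule win_by_opposite_probe[where u = h and \<sigma> = \<sigma> and
      P = "\<lambda>p q i'. p \<in> outer \<and> p + q < N \<and> i' \<le> 1"])
  have low: "{..h - 1} \<subseteq> {..<N}" "win (branches \<tau> ({..h - 1} \<inter> outer))" for \<tau>
  proof -
    have "h - 1 < N" using N_eq h_pos by linarith
    then show "{..h - 1} \<subseteq> {..<N}" by auto
    show "win (branches \<tau> ({..h - 1} \<inter> outer))"
      by (rule win_branches_singleton) (auto simp: outer_def)
  qed
  \<comment> \<open>From nodes \<open>h\<close> and above, no two nodes of \<open>outer\<close> can be reached.\<close>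
  have high: "win (branches \<sigma> {h..<N})"
  proof (rule win_branches[OF _ low])
    show "q \<in> {..h - 1}" if "p \<in> {h..<N}" "p + q < N" for p q
    proof -
      have "q \<le> h - 1" using that N_eq unfolding atLeastLessThan_iff by linarith
      then show ?thesis by simp
    qed
  qed auto
  show "h < N" using N_eq h_pos by simp
  have outer_N: "outer \<subseteq> {..<N}" by (auto simp: outer_def)
  show "\<exists>p q i. v = spot \<sigma> p q i \<and> p \<in> outer \<and> p + q < N \<and> i \<le> 1"
    if "v \<in> closed_nbhd S (branches \<sigma> outer)" for v
    using nbhd_branches[OF that outer_N] by blast
  show "p + q < N \<and> i' \<le> M" if "p \<in> outer \<and> p + q < N \<and> i' \<le> 1" for p q i' using that M by auto
  fix p q i' assume P: "p \<in> outer \<and> p + q < N \<and> i' \<le> (1 :: nat)"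
  define H where "H = (if p < h then {h - 1} else {h..<N})"
  have H: "H \<subseteq> {..<N}" "win (branches \<sigma> H)"
  proof -
    have "h - 1 < N" using N_eq h_pos by linarith
    then show "H \<subseteq> {..<N}" by (auto simp: H_def)
    have "win (branches \<sigma> {h - 1})" by (rule win_branches_singleton) simp
    then show "win (branches \<sigma> H)" unfolding H_def using high by (cases "p < h") simp_all
  qed
  have same: "p' \<in> H" if "p' \<in> outer" "h + p' < N \<longleftrightarrow> h + p < N" for p'
  proof (cases "p < h")
    case True
    then have "p' = h - 1" using that N_eq unfolding outer_def atLeastLessThan_iff by linarith
    then show ?thesis using True by (simp add: H_def)
  next
    case False
    then have "h \<le> p' \<and> p' < N" using that N_eq unfolding outer_def atLeastLessThan_iff by linarith
    then show ?thesis using False by (simp add: H_def)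
  qed
  have "i' < M" using P M_ge by simp
  consider "i' = 0" | "i' = 1" using P by linarith
  then show "\<exists>T'. win T' \<and> (\<forall>p' q'. (p' \<in> outer \<and> p' + q' < N \<and> i' \<le> 1) \<and>
      (i' < M \<longrightarrow> (h + p' < N \<longleftrightarrow> h + p < N)) \<and> (0 < i' \<longrightarrow> (h = q' \<longleftrightarrow> h = q)) \<longrightarrow>
      spot \<sigma> p' q' i' \<in> T')"
  proof cases
    case 1
    then show ?thesis using H(2) same spot_0_in_branches \<open>i' < M\<close> by blast
  next
    case 2
    show ?thesis
    proof (cases "q = h")
      case True
      have "spot \<sigma> p' q' i' \<in> {spot \<sigma> (h - 1) h 1}" if "p' \<in> outer" "p' + q' < N" "h = q'" for p' q'
      proof -
        have "p' = h - 1" using that N_eq unfolding outer_def atLeastLessThan_iff by linarith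
        then show ?thesis using that 2 by simp
      qed
      moreover have "win {spot \<sigma> (h - 1) h 1}" by (rule cop_wins.located) simp
      moreover have "0 < i'" using 2 by simp
      ultimately show ?thesis using True by blast
    next
      case False
      have "win (between \<sigma> H {..h - 1} 1)" using H low by (rule win_departed)
      moreover have "spot \<sigma> p' q' i' \<in> between \<sigma> H {..h - 1} 1"
        if "(p' \<in> outer \<and> p' + q' < N \<and> i' \<le> 1) \<and> (i' < M \<longrightarrow> (h + p' < N \<longleftrightarrow> h + p < N)) \<and>
          (0 < i' \<longrightarrow> (h = q' \<longleftrightarrow> h = q))" for p' q'
      proof -
        have *: "p' \<in> outer" "p' + q' < N" "h + p' < N \<longleftrightarrow> h + p < N" "h \<noteq> q'"
          using that 2 \<open>i' < M\<close> False by simp_all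
        then have "q' \<le> h - 1" using N_eq unfolding outer_def atLeastLessThan_iff by linarith
        then show ?thesis using same[OF *(1,3)] *(2) 2 unfolding between_def by blast
      qed
      ultimately show ?thesis by (intro exI[of _ "between \<sigma> H {..h - 1} 1"]) simp
    qed
  qed
qed

lemma win_all_branches: "win (branches \<sigma> {..<N})"
proof (rule win_branches[where Y = "{..<N}"])
  show "win (branches (\<not> \<sigma>) ({..<N} \<inter> outer))"
    using win_outer[of "\<not> \<sigma>"] by (rule cop_wins_mono) (auto simp: branches_def)
qed auto

lemma locatable_S: "k_locatable 1 S"
proof (rule k_locatable_if_cop_wins[OF wf_S])
  show "pverts S \<noteq> {}" using branch_verts N by blast
  show "win (pverts S)"
  proof (rule win_by_opposite_probe[where u = 0 and \<sigma> = True and P = "\<lambda>p q i. p + q < N \<and> i \<le> M"])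
    interpret pair_wf_digraph S by (rule wf_S)
    show "\<exists>p q i. v = spot True p q i \<and> p + q < N \<and> i \<le> M" if "v \<in> closed_nbhd S (pverts S)" for v
    proof -
      have "v \<in> pverts S" using that by (auto simp: closed_nbhd_def dest: in_arcsD2)
      then show ?thesis unfolding verts_S by blast
    qed
    fix p q i assume P: "p + q < N \<and> i \<le> M"
    consider "i = 0" | "i = M" | "0 < i" "i < M" using P by linarith
    then show "\<exists>T'. win T' \<and> (\<forall>p' q'. (p' + q' < N \<and> i \<le> M) \<and>
        (i < M \<longrightarrow> (0 + p' < N \<longleftrightarrow> 0 + p < N)) \<and> (0 < i \<longrightarrow> (0 = q' \<longleftrightarrow> 0 = q)) \<longrightarrow>
        spot True p' q' i \<in> T')"
    proof cases
      case 1
      then have "spot True p' q' i \<in> branches True {..<N}" if "p' + q' < N" for p' q'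
        using spot_0_in_branches[of p' "{..<N}" True q'] that by simp
      then show ?thesis using win_all_branches[of True] by (intro exI[of _ "branches True {..<N}"]) simp
    next
      case 2
      then have "spot True p' q' i \<in> branches False {..<N}" if "p' + q' < N" for p' q'
        using spot_M_in_branches[of q' "{..<N}" True p'] that by simp
      then show ?thesis using win_all_branches[of False] by (intro exI[of _ "branches False {..<N}"]) simp
    next
      case 3
      have "win (between True {..<N} {..<N} i)"
        using 3 win_all_branches by (intro win_between) auto
      moreover have "spot True p' q' i \<in> between True {..<N} {..<N} i" if "p' + q' < N" for p' q'
      proof -
        have "p' \<in> {..<N}" "q' \<in> {..<N}" using that by auto
        then show ?thesis using that unfolding between_def by blast
      qed
      ultimately show ?thesis by (intro exI[of _ "between True {..<N} {..<N} i"]) simp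
    qed
  qed (use N in simp_all)
qed

end

section \<open>Escaping in short subdivisions\<close>

context subdivided_half_graph
begin

definition fan :: "bool \<Rightarrow> nat \<Rightarrow> nat set \<Rightarrow> nat \<Rightarrow> nat sub_vertex set" where
  "fan \<sigma> c X i = (\<lambda>x. spot \<sigma> c x i) ` X"

text \<open>
  A fan needs enough paths for two of them to survive the remaining \<open>M - i\<close> probes, each of which may
  remove one path and half of the others.
\<close>

definition escape_sets :: "nat \<Rightarrow> nat sub_vertex set set" where
  "escape_sets h =
     {branches \<sigma> {a, a'} |\<sigma> a a'. a \<noteq> a' \<and> a \<le> h \<and> a' \<le> h} \<union>
     {fan \<sigma> c X i |\<sigma> c X i. c < h \<and> X \<subseteq> {..h} \<and> 0 < i \<and> i < M \<and> 2 ^ Suc (M - i) \<le> card X}"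

lemma vert_on_side:
  assumes "w \<in> pverts S"
  shows "\<exists>u v s. u + v < N \<and> s \<le> M \<and> w = spot \<sigma> u v s"
proof -
  obtain p q i where pqi: "p + q < N" "i \<le> M" "w = spot True p q i" using assms unfolding verts_S by blast
  show ?thesis
  proof (cases \<sigma>)
    case True
    then show ?thesis using pqi by (intro exI[of _ p] exI[of _ q] exI[of _ i]) simp
  next
    case False
    then show ?thesis using pqi pos_flip[of i M N True q p]
      by (intro exI[of _ q] exI[of _ p] exI[of _ "M - i"]) (simp add: add.commute)
  qed
qed

lemma exists_two: "2 \<le> card X \<Longrightarrow> \<exists>x \<in> X. \<exists>y \<in> X. x \<noteq> y"
proof (rule ccontr)
  assume "2 \<le> card X" and none: "\<not> (\<exists>x \<in> X. \<exists>y \<in> X. x \<noteq> y)"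
  then obtain x where "x \<in> X" by fastforce
  with none have "X = {x}" by blast
  then show False using \<open>2 \<le> card X\<close> by simp
qed

lemma escape_sets_nontrivial:
  assumes N_eq: "N = 2 * h" and T: "T \<in> escape_sets h"
  shows "T \<subseteq> pverts S \<and> (\<exists>x \<in> T. \<exists>y \<in> T. x \<noteq> y)"
  using T unfolding escape_sets_def
proof (elim UnE CollectE exE conjE)
  fix \<sigma> a a' assume a: "a \<noteq> a'" "a \<le> h" "a' \<le> h" and T: "T = branches \<sigma> {a, a'}"
  have "a < N" "a' < N" using a N N_eq by linarith+
  moreover from this have "branch \<sigma> a \<noteq> branch \<sigma> a'"
    using spot_eq_iff_full[of a 0 a' 0 0 0 \<sigma>] a(1) M by simp
  ultimately have "branch \<sigma> a \<in> T" "branch \<sigma> a' \<in> T" "T \<subseteq> pverts S" "branch \<sigma> a \<noteq> branch \<sigma> a'"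
    by (auto simp: T branches_def branch_verts)
  then show ?thesis by blast
next
  fix \<sigma> c X i assume c: "c < h" "X \<subseteq> {..h}" "0 < i" "i < M" "2 ^ Suc (M - i) \<le> card X"
    and T: "T = fan \<sigma> c X i"
  have cx: "c + x < N" if "x \<in> X" for x
  proof -
    have "x \<le> h" using that c(2) by auto
    then show ?thesis using c(1) N_eq by linarith
  qed
  have "(2 :: nat) \<le> 2 ^ Suc (M - i)" by simp
  then obtain x y where xy: "x \<in> X" "y \<in> X" "x \<noteq> y" using exists_two[of X] c(5) by (meson le_trans)
  have "spot \<sigma> c x i \<noteq> spot \<sigma> c y i"
    using spot_eq_iff_full[OF cx[OF xy(1)] cx[OF xy(2)], of i i \<sigma>] c(3,4) xy(3) by simp
  moreover have "spot \<sigma> c x i \<in> T" "spot \<sigma> c y i \<in> T" using xy by (simp_all add: T fan_def)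
  moreover have "T \<subseteq> pverts S" unfolding T fan_def using cx c(4) by (auto intro!: spot_verts)
  ultimately show ?thesis by blast
qed

text \<open>
  A probe on the path from \<open>u\<close> to \<open>v\<close> sees the far ends other than \<open>v\<close> at two distances only, according
  to their adjacency to \<open>u\<close>. The larger class is kept.
\<close>

lemma fan_step:
  assumes N_eq: "N = 2 * h" and c: "c < h" "X \<subseteq> {..h}" and i: "0 < i" "i < M"
    and X: "2 ^ Suc (M - i) \<le> card X" and w: "w \<in> pverts S"
  shows "\<exists>T' \<in> escape_sets h. T' \<subseteq> closed_nbhd S (fan \<sigma> c X i) \<and>
    (\<forall>x \<in> T'. \<forall>y \<in> T'. graph_dist S x w = graph_dist S y w)"
proof -
  obtain u v s where w: "u + v < N" "s \<le> M" "w = spot \<sigma> u v s" using vert_on_side[OF w] by blast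
  define A where "A = {x \<in> X - {v}. x + u < N}"
  define B where "B = {x \<in> X - {v}. \<not> x + u < N}"
  have fin: "finite X" using c(2) by (auto intro: finite_subset)
  have "A \<union> B = X - {v}" "A \<inter> B = {}" by (auto simp: A_def B_def)
  then have "card A + card B = card (X - {v})"
    using fin card_Un_disjoint[of A B] by (simp add: A_def B_def)
  moreover have "card X \<le> Suc (card (X - {v}))" using card_Suc_Diff1[OF fin, of v] by (cases "v \<in> X") simp_all
  moreover have "2 ^ Suc (M - i) = 2 * (2 :: nat) ^ (M - i)" by simp
  ultimately have "2 ^ (M - i) \<le> card A \<or> 2 ^ (M - i) \<le> card B" using X by linarith
  then obtain Y where Y: "2 ^ (M - i) \<le> card Y" "Y = A \<or> Y = B" by blast
  have YX: "Y \<subseteq> X" "v \<notin> Y" using Y(2) by (auto simp: A_def B_def)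
  have cx: "c + x < N" if "x \<in> X" for x
  proof -
    have "x \<le> h" using that c(2) by auto
    then show ?thesis using c(1) N_eq by linarith
  qed
  have same: "graph_dist S (spot \<sigma> c x (Suc i)) w = graph_dist S (spot \<sigma> c y (Suc i)) w"
    if "x \<in> Y" "y \<in> Y" for x y
  proof -
    have "x \<noteq> v" "y \<noteq> v" using that YX by blast+
    moreover have "x + u < N \<longleftrightarrow> y + u < N" using that Y(2) by (auto simp: A_def B_def)
    ultimately have "pos_dist N M u v s c x (Suc i) = pos_dist N M u v s c y (Suc i)"
      by (simp add: pos_dist_def end_dist_def)
    moreover have "c + x < N" "c + y < N" "Suc i \<le> M" using cx that YX i by auto
    ultimately show ?thesis using w by (simp add: dist_S)
  qed
  have fan_same: "\<forall>x' \<in> fan \<sigma> c Z (Suc i). \<forall>y' \<in> fan \<sigma> c Z (Suc i). graph_dist S x' w = graph_dist S y' w"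
    if "Z \<subseteq> Y" for Z
  proof (intro ballI)
    fix x' y' assume "x' \<in> fan \<sigma> c Z (Suc i)" "y' \<in> fan \<sigma> c Z (Suc i)"
    then obtain x y where "x \<in> Z" "y \<in> Z" "x' = spot \<sigma> c x (Suc i)" "y' = spot \<sigma> c y (Suc i)"
      unfolding fan_def by blast
    then show "graph_dist S x' w = graph_dist S y' w" using same[of x y] \<open>Z \<subseteq> Y\<close> by blast
  qed
  have sub: "fan \<sigma> c Y (Suc i) \<subseteq> closed_nbhd S (fan \<sigma> c X i)"
  proof
    fix z assume "z \<in> fan \<sigma> c Y (Suc i)"
    then obtain x where x: "x \<in> Y" "z = spot \<sigma> c x (Suc i)" by (auto simp: fan_def)
    then have "(spot \<sigma> c x i, z) \<in> parcs S" "spot \<sigma> c x i \<in> fan \<sigma> c X i"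
      using spot_arc(1)[OF cx i(2), of x \<sigma>] YX by (auto simp: fan_def)
    then show "z \<in> closed_nbhd S (fan \<sigma> c X i)" unfolding closed_nbhd_def by blast
  qed
  show ?thesis
  proof (cases "Suc i < M")
    case True
    have "Suc (M - Suc i) = M - i" using True by simp
    then have "c < h \<and> Y \<subseteq> {..h} \<and> 0 < Suc i \<and> Suc i < M \<and> 2 ^ Suc (M - Suc i) \<le> card Y"
      using Y(1) c YX(1) True by auto
    then have "fan \<sigma> c Y (Suc i) \<in> escape_sets h"
      unfolding escape_sets_def by (intro UnI2 CollectI exI conjI) (rule refl, simp_all)
    then show ?thesis using sub fan_same[OF order_refl] by blast
  next
    case False
    then have iM: "Suc i = M" using i by simp
    then have "M - i = 1" by simp
    then have "2 \<le> card Y" using Y(1) by simp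
    then obtain x y where xy: "x \<in> Y" "y \<in> Y" "x \<noteq> y" using exists_two by blast
    have "x \<le> h" "y \<le> h" using xy(1,2) YX(1) c(2) by auto
    then have "branches (\<not> \<sigma>) {x, y} \<in> escape_sets h"
      unfolding escape_sets_def using xy(3) by (intro UnI1 CollectI exI conjI) (rule refl, simp_all)
    moreover have eq: "branches (\<not> \<sigma>) {x, y} = fan \<sigma> c {x, y} (Suc i)"
      unfolding branches_def fan_def iM spot_M ..
    moreover have xyY: "{x, y} \<subseteq> Y" using xy by blast
    moreover have "fan \<sigma> c {x, y} (Suc i) \<subseteq> fan \<sigma> c Y (Suc i)"
      unfolding fan_def using xyY by (rule image_mono)
    ultimately show ?thesis using sub fan_same[OF xyY] by (metis subset_trans)
  qed
qed

lemma dist_from_branch: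
  assumes "p < N" "u + v < N" "s \<le> M"
  shows "graph_dist S (branch \<sigma> p) (spot \<sigma> u v s) = ereal (real (end_dist N M u v s p))"
  using dist_S[OF assms(2,3), of p 0 0 \<sigma>] pos_dist_start[OF assms(2), of p 0 s M] assms by simp

text \<open>
  A probe that separates the pair lies on a path from some \<open>u \<le> h\<close>. All nodes up to \<open>h\<close> look alike
  from it, with the exception of one: this is \<open>v\<close>, or, if the probe is at the node \<open>h\<close> itself, the node
  \<open>h\<close> of the other side. If the probe is an inner point of a path from \<open>h\<close>, both of them look
  different, but the first points of the paths from \<open>c\<close>, other than that to \<open>v\<close>, are then reached through
  \<open>c\<close> at the same distance.
\<close>

lemma branches_step:
  assumes N_eq: "N = 2 * h" and h_eq: "h = 2 ^ M" and M2: "2 \<le> M"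
    and a: "a \<noteq> a'" "a \<le> h" "a' \<le> h" and w: "w \<in> pverts S"
  shows "\<exists>T' \<in> escape_sets h. T' \<subseteq> closed_nbhd S (branches \<sigma> {a, a'}) \<and>
    (\<forall>x \<in> T'. \<forall>y \<in> T'. graph_dist S x w = graph_dist S y w)"
proof -
  obtain u v s where w: "u + v < N" "s \<le> M" "w = spot \<sigma> u v s" using vert_on_side[OF w] by blast
  have aN: "a < N" "a' < N" using a N N_eq by linarith+
  show ?thesis
  proof (cases "end_dist N M u v s a = end_dist N M u v s a'")
    case True
    then have "\<forall>x \<in> branches \<sigma> {a, a'}. \<forall>y \<in> branches \<sigma> {a, a'}. graph_dist S x w = graph_dist S y w"
      using w aN by (simp add: branches_def dist_from_branch)
    moreover have "branches \<sigma> {a, a'} \<in> escape_sets h" unfolding escape_sets_def using a by blast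
    ultimately show ?thesis unfolding closed_nbhd_def by blast
  next
    case False
    have "u \<le> h"
    proof (rule ccontr)
      assume "\<not> u \<le> h"
      then have "a \<noteq> u" "a' \<noteq> u" "a + v < N" "a' + v < N" using a w(1) N_eq by linarith+
      then show False using False by (simp add: end_dist_def)
    qed
    \<comment> \<open>A node that is adjacent to all nodes up to \<open>h\<close>.\<close>
    obtain c where c: "c \<in> {a, a'}" "c < h" using a by (metis insertCI le_neq_implies_less)
    define X where "X = (if u = h \<and> s = 0 then {..<h} else {..h} - {v})"
    have Xh: "X \<subseteq> {..h}" by (auto simp: X_def)
    have "h \<le> card X" by (simp add: X_def card_Diff_singleton_if)
    then have card_X: "2 ^ Suc (M - 1) \<le> card X" using M2 h_eq by (cases M) simp_all
    have fan: "fan \<sigma> c X 1 \<in> escape_sets h"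
      unfolding escape_sets_def using c(2) Xh card_X M2
      by (intro UnI2 CollectI exI[of _ \<sigma>] exI[of _ c] exI[of _ X] exI[of _ 1]) simp
    have cx: "c + x < N" if "x \<in> X" for x
    proof -
      have "x \<le> h" using that Xh by auto
      then show ?thesis using c(2) N_eq by linarith
    qed
    define d where "d = (if u = h \<and> s \<noteq> 0 then 2 * M - s + 1
      else min (end_dist N M u v s c + 1) (M + s + (M - 1)))"
    have same: "pos_dist N M u v s c x 1 = d" if "x \<in> X" for x
    proof -
      have x: "x \<le> h" using that Xh by auto
      show ?thesis
      proof (cases "u = h")
        case False
        then have "x \<noteq> v" "x + u < N" using that x \<open>u \<le> h\<close> N_eq by (simp_all add: X_def)
        then show ?thesis using False w(2) by (simp add: pos_dist_def end_dist_def d_def)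
      next
        case True
        then have v: "v < h" using w(1) N_eq by linarith
        then have "c \<noteq> u" "c + v < N" using True c(2) N_eq by linarith+
        then have end_c: "end_dist N M u v s c = 2 * M - s" by (simp add: end_dist_def)
        have eq: "pos_dist N M u v s c x 1 =
            min (2 * M - s + 1) (end_dist N M v u (M - s) x + (M - 1))"
          using \<open>c \<noteq> u\<close> end_c by (simp add: pos_dist_def)
        show ?thesis
        proof (cases "s = 0")
          case s0: True
          then have "x + u < N" using that True N_eq by (simp add: X_def)
          then have "end_dist N M v u (M - s) x = M" using s0 by (simp add: end_dist_def)
          then show ?thesis using s0 eq end_c by (simp add: d_def)
        next
          case False
          then have "x \<noteq> v" using that by (simp add: X_def)
          then have "M + s \<le> end_dist N M v u (M - s) x" using w(2) by (auto simp: end_dist_def)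
          then have "2 * M - s + 1 \<le> end_dist N M v u (M - s) x + (M - 1)"
            using False M by linarith
          then show ?thesis using False True eq by (simp add: d_def)
        qed
      qed
    qed
    have dist: "graph_dist S (spot \<sigma> c x 1) w = ereal (real d)" if "x \<in> X" for x
      using dist_S[OF w(1,2) cx[OF that], of 1 \<sigma>] same[OF that] w(3) M by simp
    have "fan \<sigma> c X 1 \<subseteq> closed_nbhd S (branches \<sigma> {a, a'})"
    proof
      fix z assume "z \<in> fan \<sigma> c X 1"
      then obtain x where x: "x \<in> X" "z = spot \<sigma> c x 1" by (auto simp: fan_def)
      have "(spot \<sigma> c x 0, z) \<in> parcs S" using spot_arc(1)[OF cx[OF x(1)] M, of \<sigma>] x(2) by simp
      moreover have "spot \<sigma> c x 0 \<in> branches \<sigma> {a, a'}" using c(1) by (rule spot_0_in_branches)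
      ultimately show "z \<in> closed_nbhd S (branches \<sigma> {a, a'})" unfolding closed_nbhd_def by blast
    qed
    then show ?thesis using fan dist by (intro bexI[of _ "fan \<sigma> c X 1"]) (auto simp: fan_def)
  qed
qed

lemma not_locatable_S:
  assumes N_eq: "N = 2 * h" and h_eq: "h = 2 ^ M" and M2: "2 \<le> M"
  shows "\<not> k_locatable 1 S"
proof (rule not_k_locatable_if_evasive[OF wf_S finite_S, where F = "escape_sets h"])
  show "T \<subseteq> pverts S \<and> (\<exists>x \<in> T. \<exists>y \<in> T. x \<noteq> y)" if "T \<in> escape_sets h" for T
    using escape_sets_nontrivial[OF N_eq that] .
  have "1 \<le> h" by (simp add: h_eq)
  then have "branches True {0, 1} \<in> escape_sets h"
    unfolding escape_sets_def by (intro UnI1 CollectI exI[of _ True] exI[of _ 0] exI[of _ 1]) simp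
  then show "escape_sets h \<noteq> {}" by blast
  fix T us assume T: "T \<in> escape_sets h" and us: "length us = 1" "set us \<subseteq> pverts S"
  then obtain w where w: "us = [w]" "w \<in> pverts S" by (cases us) auto
  have "\<exists>T' \<in> escape_sets h. T' \<subseteq> closed_nbhd S T \<and>
      (\<forall>x \<in> T'. \<forall>y \<in> T'. graph_dist S x w = graph_dist S y w)"
  proof -
    consider (pair) \<sigma> a a' where "a \<noteq> a'" "a \<le> h" "a' \<le> h" "T = branches \<sigma> {a, a'}"
      | (fan) \<sigma> c X i where "c < h" "X \<subseteq> {..h}" "0 < i" "i < M" "2 ^ Suc (M - i) \<le> card X"
          "T = fan \<sigma> c X i"
      using T unfolding escape_sets_def by (elim UnE CollectE exE conjE)
    then show ?thesis
    proof cases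
      case pair
      show ?thesis unfolding pair(4) by (rule branches_step[OF assms pair(1-3) w(2)])
    next
      case fan
      show ?thesis unfolding fan(6) by (rule fan_step[OF N_eq fan(1-5) w(2)])
    qed
  qed
  then show "\<exists>T' \<in> escape_sets h. T' \<subseteq> closed_nbhd S T \<and>
      (\<forall>x \<in> T'. \<forall>y \<in> T'. replies S us x = replies S us y)"
    by (simp add: replies_def w(1))
qed

end

section \<open>The number of simultaneous probes\<close>

lemma node_in_verts: "p < N \<Longrightarrow> node N \<sigma> p \<in> pverts (half_graph N)"
  unfolding half_graph_verts by blast

lemma half_graph_dist_eqD:
  assumes "p < N" "p' < N" "u < N"
    and "graph_dist (half_graph N) (node N \<sigma> p) (node N \<tau> u) =
      graph_dist (half_graph N) (node N \<sigma>' p') (node N \<tau> u)"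
  shows "\<sigma> = \<sigma>' \<and> (\<sigma> = \<tau> \<longrightarrow> (p = u \<longleftrightarrow> p' = u)) \<and> (\<sigma> \<noteq> \<tau> \<longrightarrow> (p + u < N \<longleftrightarrow> p' + u < N))"
  using assms(4) unfolding half_graph_dist[OF assms(1,3)] half_graph_dist[OF assms(2,3)]
  by (auto split: if_splits)

lemma replies_eqD:
  "replies G us x = replies G us y \<Longrightarrow> u \<in> set us \<Longrightarrow> graph_dist G x u = graph_dist G y u"
  by (simp add: replies_def)

text \<open>
  The probes on the same side remove singletons. Those on the other side are thresholds, so the number
  of them that are adjacent to \<open>q\<close> determines which ones are. By the pigeonhole principle two of the
  remaining nodes agree in this number.
\<close>

lemma unresolved_pair:
  assumes us: "set us \<subseteq> pverts (half_graph N)" "length us < h" and hN: "h < N"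
  shows "\<exists>q q'. q \<noteq> q' \<and> q \<le> h \<and> q' \<le> h \<and>
    replies (half_graph N) us (node N \<tau> q) = replies (half_graph N) us (node N \<tau> q')"
proof -
  define own where "own = {u. u < N \<and> node N \<tau> u \<in> set us}"
  define opp where "opp = {u. u < N \<and> node N (\<not> \<tau>) u \<in> set us}"
  have fin: "finite own" "finite opp" by (auto simp: own_def opp_def)
  have inj: "inj_on (node N \<sigma>) {..<N}" for \<sigma> by (auto simp: inj_on_def node_def)
  have "card own = card (node N \<tau> ` own)" "card opp = card (node N (\<not> \<tau>) ` opp)"
    by (auto simp: own_def opp_def intro!: card_image[symmetric] inj_on_subset[OF inj])
  moreover have "card (node N \<tau> ` own) + card (node N (\<not> \<tau>) ` opp) =
      card (node N \<tau> ` own \<union> node N (\<not> \<tau>) ` opp)"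
    using fin by (intro card_Un_disjoint[symmetric]) (auto simp: own_def opp_def node_eq_iff)
  moreover have "card (node N \<tau> ` own \<union> node N (\<not> \<tau>) ` opp) \<le> card (set us)"
    by (intro card_mono) (auto simp: own_def opp_def)
  ultimately have few: "card own + card opp < h" using us(2) card_length[of us] by linarith
  define g where "g q = card {u \<in> opp. q + u < N}" for q
  have "\<not> inj_on g ({..h} - own)"
  proof
    assume "inj_on g ({..h} - own)"
    moreover have "g ` ({..h} - own) \<subseteq> {..card opp}"
      using fin(2) by (auto simp: g_def intro: card_mono)
    ultimately have "card ({..h} - own) \<le> card {..card opp}" by (intro card_inj_on_le) auto
    moreover have "card {..h} - card own \<le> card ({..h} - own)" by (rule diff_card_le_card_Diff[OF fin(1)])
    ultimately show False using few by simp
  qed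
  then obtain q q' where q: "q \<in> {..h} - own" "q' \<in> {..h} - own" "g q = g q'" "q \<noteq> q'"
    unfolding inj_on_def by blast
  have nested: "{u \<in> opp. y + u < N} = {u \<in> opp. x + u < N}" if "x \<le> y" "g x = g y" for x y
    using that fin(2) by (intro card_subset_eq) (auto simp: g_def)
  have opp_eq: "{u \<in> opp. q + u < N} = {u \<in> opp. q' + u < N}"
  proof (cases "q \<le> q'")
    case True
    show ?thesis by (rule nested[OF True q(3), symmetric])
  next
    case False
    then have "q' \<le> q" by simp
    then show ?thesis using q(3)[symmetric] by (rule nested)
  qed
  have "graph_dist (half_graph N) (node N \<tau> q) w = graph_dist (half_graph N) (node N \<tau> q') w"
    if "w \<in> set us" for w
  proof -
    have "w \<in> pverts (half_graph N)" using us(1) that by blast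
    then obtain \<sigma> u where u: "u < N" "w = node N \<sigma> u" unfolding half_graph_verts by blast
    have qN: "q < N" "q' < N" using q hN by auto
    show ?thesis
    proof (cases "\<sigma> = \<tau>")
      case True
      then have "u \<in> own" using u that by (simp add: own_def)
      then have "q \<noteq> u" "q' \<noteq> u" using q by auto
      then show ?thesis unfolding u(2) half_graph_dist[OF qN(1) u(1)] half_graph_dist[OF qN(2) u(1)]
        using True by simp
    next
      case False
      then have "\<sigma> = (\<not> \<tau>)" by blast
      then have "u \<in> opp" using u that by (simp add: opp_def)
      then have "q + u < N \<longleftrightarrow> q' + u < N" using opp_eq by blast
      then show ?thesis unfolding u(2) half_graph_dist[OF qN(1) u(1)] half_graph_dist[OF qN(2) u(1)]
        using False by simp
    qed
  qed
  then have "replies (half_graph N) us (node N \<tau> q) = replies (half_graph N) us (node N \<tau> q')"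
    by (simp add: replies_def)
  then show ?thesis using q by (intro exI[of _ q] exI[of _ q']) simp
qed

lemma half_graph_not_k_locatable:
  assumes "k < h"
  shows "\<not> k_locatable k (half_graph (2 * h))"
proof (rule not_k_locatable_if_evasive[OF half_graph_wf, where
      F = "{{node (2 * h) \<sigma> a, node (2 * h) \<sigma> a'} |\<sigma> a a'. a \<noteq> a' \<and> a \<le> h \<and> a' \<le> h}"])
  let ?F = "{{node (2 * h) \<sigma> a, node (2 * h) \<sigma> a'} |\<sigma> a a'. a \<noteq> a' \<and> a \<le> h \<and> a' \<le> h}"
  let ?G = "half_graph (2 * h)"
  have h: "h < 2 * h" using assms by simp
  show "finite (pverts ?G)" by (simp add: half_graph_def)
  show "T \<subseteq> pverts ?G \<and> (\<exists>x \<in> T. \<exists>y \<in> T. x \<noteq> y)" if "T \<in> ?F" for T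
  proof -
    obtain \<sigma> a a' where T: "T = {node (2 * h) \<sigma> a, node (2 * h) \<sigma> a'}" "a \<noteq> a'" "a \<le> h" "a' \<le> h"
      using \<open>T \<in> ?F\<close> by blast
    then have "a < 2 * h" "a' < 2 * h" using h by simp_all
    then show ?thesis using T(2) node_eq_iff[of a "2 * h" a' \<sigma> \<sigma>] unfolding T(1)
      by (auto simp: half_graph_verts)
  qed
  have "{node (2 * h) True 0, node (2 * h) True 1} \<in> ?F"
    using assms by (intro CollectI exI[of _ True] exI[of _ 0] exI[of _ 1]) simp
  then show "?F \<noteq> {}" by blast
  fix T us assume T: "T \<in> ?F" and us: "length us = k" "set us \<subseteq> pverts ?G"
  obtain \<sigma> a a' where T: "T = {node (2 * h) \<sigma> a, node (2 * h) \<sigma> a'}" "a \<noteq> a'" "a \<le> h" "a' \<le> h"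
    using T by blast
  then obtain c where c: "node (2 * h) \<sigma> c \<in> T" "c < h" by (metis insertCI le_neq_implies_less)
  obtain q q' where q: "q \<noteq> q'" "q \<le> h" "q' \<le> h"
    "replies ?G us (node (2 * h) (\<not> \<sigma>) q) = replies ?G us (node (2 * h) (\<not> \<sigma>) q')"
    using unresolved_pair[OF us(2) _ h, of "\<not> \<sigma>"] us(1) assms by blast
  have "node (2 * h) (\<not> \<sigma>) x \<in> closed_nbhd ?G T" if "x \<le> h" for x
  proof -
    have "c + x < 2 * h" using c(2) that by simp
    then have "(node (2 * h) \<sigma> c, node (2 * h) (\<not> \<sigma>) x) \<in> parcs ?G" unfolding half_graph_arcs by blast
    then show ?thesis using c(1) unfolding closed_nbhd_def by blast
  qed
  moreover have "{node (2 * h) (\<not> \<sigma>) q, node (2 * h) (\<not> \<sigma>) q'} \<in> ?F" using q by blast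
  ultimately show "\<exists>T' \<in> ?F. T' \<subseteq> closed_nbhd ?G T \<and> (\<forall>x \<in> T'. \<forall>y \<in> T'. replies ?G us x = replies ?G us y)"
    using q by (intro bexI[of _ "{node (2 * h) (\<not> \<sigma>) q, node (2 * h) (\<not> \<sigma>) q'}"]) auto
qed

locale even_half_graph =
  fixes h N :: nat
  assumes h: "0 < h" and N_eq: "N = 2 * h"
begin

abbreviation G :: "nat pair_pre_digraph" where
  "G \<equiv> half_graph N"

text \<open>
  The cop probes all nodes above \<open>h\<close> on side \<open>\<tau>\<close>, which resolve the other side except for its nodes
  from \<open>h - 1\<close> on, and one node \<open>k\<close> of the first side.
\<close>

definition probes :: "bool \<Rightarrow> nat \<Rightarrow> nat list" where
  "probes \<tau> k = node N True k # map (node N \<tau>) [Suc h..<N]"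

lemma probes:
  assumes "k \<le> h"
  shows "length (probes \<tau> k) = h" "set (probes \<tau> k) \<subseteq> pverts G"
    "node N True k \<in> set (probes \<tau> k)" "\<And>u. h < u \<Longrightarrow> u < N \<Longrightarrow> node N \<tau> u \<in> set (probes \<tau> k)"
proof -
  have "k < N" using assms h N_eq by simp
  then show "set (probes \<tau> k) \<subseteq> pverts G"
    unfolding probes_def by (auto intro: node_in_verts)
  have "N - Suc h = h - 1" using N_eq by simp
  then show "length (probes \<tau> k) = h" using h by (simp add: probes_def)
qed (auto simp: probes_def)

lemma probes_separate:
  assumes "k \<le> h" "r < N" "r' < N"
    and eq: "replies G (probes \<tau> k) (node N \<sigma> r) = replies G (probes \<tau> k) (node N \<sigma>' r')"
  shows "\<sigma> = \<sigma>'" "\<sigma> \<Longrightarrow> r = k \<longleftrightarrow> r' = k" "\<not> \<sigma> \<Longrightarrow> r + k < N \<longleftrightarrow> r' + k < N"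
    "\<sigma> = \<tau> \<Longrightarrow> h < r \<Longrightarrow> r = r'" "\<sigma> \<noteq> \<tau> \<Longrightarrow> min r (h - 1) = min r' (h - 1)"
proof -
  note D = replies_eqD[OF eq]
  have kN: "k < N" using assms(1) h N_eq by simp
  from half_graph_dist_eqD[OF assms(2,3) kN D[OF probes(3)[OF assms(1)]]]
  show \<sigma>: "\<sigma> = \<sigma>'" and "\<sigma> \<Longrightarrow> r = k \<longleftrightarrow> r' = k" "\<not> \<sigma> \<Longrightarrow> r + k < N \<longleftrightarrow> r' + k < N"
    by auto
  have far: "(\<sigma> = \<tau> \<longrightarrow> (r = u \<longleftrightarrow> r' = u)) \<and> (\<sigma> \<noteq> \<tau> \<longrightarrow> (r + u < N \<longleftrightarrow> r' + u < N))"
    if "h < u" "u < N" for u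
    using half_graph_dist_eqD[OF assms(2,3) that(2) D[OF probes(4)[OF assms(1) that]]] by blast
  show "r = r'" if "\<sigma> = \<tau>" "h < r" using far[of r] that assms(2) by blast
  show "min r (h - 1) = min r' (h - 1)" if "\<sigma> \<noteq> \<tau>"
  proof (rule ccontr)
    \<comment> \<open>The probe at \<open>N - t\<close> is adjacent to exactly the nodes below \<open>t\<close>.\<close>
    define t where "t = Suc (min r r')"
    assume "min r (h - 1) \<noteq> min r' (h - 1)"
    then have "t \<le> h - 1" "r < t \<longleftrightarrow> \<not> r' < t" unfolding t_def by linarith+
    moreover from this have "h < N - t" "N - t < N" using N_eq h unfolding t_def by linarith+
    ultimately show False using far[of "N - t"] that N_eq by auto
  qed
qed

abbreviation win :: "nat set \<Rightarrow> bool" where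
  "win \<equiv> cop_wins h G"

lemma nbhd_node:
  assumes "v \<in> closed_nbhd G T" "\<And>x. x \<in> T \<Longrightarrow> x \<in> pverts G"
  shows "\<exists>\<sigma> r. r < N \<and> v = node N \<sigma> r \<and>
    (v \<in> T \<or> (\<exists>r'. r + r' < N \<and> node N (\<not> \<sigma>) r' \<in> T))"
proof (cases "v \<in> T")
  case True
  then show ?thesis using assms(2) unfolding half_graph_verts by blast
next
  case False
  then obtain x where "x \<in> T" "(x, v) \<in> parcs G" using assms(1) by (auto simp: closed_nbhd_def)
  then obtain \<sigma> p q where *: "p + q < N" "node N \<sigma> p \<in> T" "v = node N (\<not> \<sigma>) q"
    unfolding half_graph_arcs by blast
  then have "q < N" "q + p < N" by simp_all
  with * show ?thesis by (intro exI[of _ "\<not> \<sigma>"] exI[of _ q]) auto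
qed

text \<open>
  Probing the nodes above \<open>h\<close> on the second side leaves only the nodes \<open>h - 1\<close> and \<open>h\<close> of each side in
  doubt. The additional probe at \<open>h\<close> on the first side resolves both pairs: the one on its own side because it
  is the probed node, and the other because \<open>h\<close> is adjacent to \<open>h - 1\<close> but not to \<open>h\<close>.
\<close>

lemma win_high: "win {node N False q |q. h - 1 \<le> q \<and> q < N}"
proof (rule cop_wins_probeI[OF probes(1,2)[OF order_refl, of False]])
  let ?T = "{node N False q |q. h - 1 \<le> q \<and> q < N}"
  have nbhd: "\<exists>\<sigma> r. r < N \<and> v = node N \<sigma> r \<and> (if \<sigma> then r \<le> h else h - 1 \<le> r)"
    if v: "v \<in> closed_nbhd G ?T" for v
  proof -
    have "x \<in> pverts G" if "x \<in> ?T" for x using that unfolding half_graph_verts by blast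
    from nbhd_node[OF v this] obtain \<sigma> r where r: "r < N" "v = node N \<sigma> r"
      "v \<in> ?T \<or> (\<exists>r'. r + r' < N \<and> node N (\<not> \<sigma>) r' \<in> ?T)" by blast
    have mem: "\<not> \<tau> \<and> h - 1 \<le> s" if "node N \<tau> s \<in> ?T" "s < N" for \<tau> s
      using that by (auto simp: node_eq_iff)
    from r(3) have "if \<sigma> then r \<le> h else h - 1 \<le> r"
    proof
      assume "v \<in> ?T"
      then show ?thesis using mem[of \<sigma> r] r by simp
    next
      assume "\<exists>r'. r + r' < N \<and> node N (\<not> \<sigma>) r' \<in> ?T"
      then obtain r' where r': "r + r' < N" "node N (\<not> \<sigma>) r' \<in> ?T" by blast
      then have "\<sigma>" "h - 1 \<le> r'" using mem[of "\<not> \<sigma>" r'] by simp_all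
      then show ?thesis using r'(1) N_eq by simp
    qed
    then show ?thesis using r by blast
  qed
  fix v assume v: "v \<in> closed_nbhd G ?T"
  obtain \<sigma> r where r: "r < N" "v = node N \<sigma> r" "if \<sigma> then r \<le> h else h - 1 \<le> r" using nbhd[OF v] by blast
  have "v' = v" if v': "v' \<in> closed_nbhd G ?T"
    "replies G (probes False h) v' = replies G (probes False h) v" for v'
  proof -
    obtain \<sigma>' r' where r': "r' < N" "v' = node N \<sigma>' r'" "if \<sigma>' then r' \<le> h else h - 1 \<le> r'"
      using nbhd[OF v'(1)] by blast
    note sep = probes_separate[OF order_refl r'(1) r(1), of False \<sigma>' \<sigma>]
      and sep' = probes_separate[OF order_refl r(1) r'(1), of False \<sigma> \<sigma>']
    have eq: "replies G (probes False h) (node N \<sigma>' r') = replies G (probes False h) (node N \<sigma> r)"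
      using v'(2) r(2) r'(2) by simp
    have \<sigma>: "\<sigma>' = \<sigma>" by (rule sep(1)[OF eq])
    have "r' = r"
    proof (cases \<sigma>)
      case True
      then have h_iff: "r' = h \<longleftrightarrow> r = h" and min_eq: "min r' (h - 1) = min r (h - 1)"
        using sep(2)[OF eq] sep(5)[OF eq] \<sigma> by blast+
      have "r \<le> h" "r' \<le> h" using r(3) r'(3) True \<sigma> by presburger+
      then show ?thesis using h_iff min_eq by (cases "r = h") linarith+
    next
      case False
      then have h_iff: "r' + h < N \<longleftrightarrow> r + h < N"
        and self: "h < r' \<longrightarrow> r' = r" "h < r \<longrightarrow> r = r'"
        using sep(3)[OF eq] sep(4)[OF eq] sep'(4)[OF eq[symmetric]] \<sigma> by blast+
      have "h - 1 \<le> r" "h - 1 \<le> r'" using r(3) r'(3) False \<sigma> by presburger+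
      then show ?thesis using h_iff self N_eq by (cases "h < r \<or> h < r'") linarith+
    qed
    then show ?thesis using r(2) r'(2) \<sigma> by simp
  qed
  moreover have "win {v}" by (rule cop_wins.located) simp
  ultimately show "\<exists>T'. win T' \<and> (\<forall>v' \<in> closed_nbhd G ?T.
      replies G (probes False h) v' = replies G (probes False h) v \<longrightarrow> v' \<in> T')"
    by blast
qed

text \<open>
  If the robber shows up on the second side, he is located or in the set treated before. So he has to
  stay where he is on the first side, where the single probe at \<open>k\<close> excludes one node in every turn.
\<close>

lemma win_sweep:
  assumes T: "T \<subseteq> pverts G" and k: "k \<le> h" and low: "\<And>p. p < k \<Longrightarrow> node N True p \<notin> closed_nbhd G T"
    and rest: "win {node N True p |p. k < p \<and> p \<le> h}"
  shows "win T"
proof (rule cop_wins_probeI[OF probes(1,2)[OF k, of True]])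
  interpret pair_wf_digraph G by (rule half_graph_wf)
  have nbhd: "\<exists>\<sigma> r. r < N \<and> v = node N \<sigma> r" if "v \<in> closed_nbhd G T" for v
  proof -
    have "v \<in> pverts G" using that T by (auto simp: closed_nbhd_def dest: in_arcsD2)
    then show ?thesis unfolding half_graph_verts by blast
  qed
  fix v assume v: "v \<in> closed_nbhd G T"
  obtain \<sigma> r where r: "r < N" "v = node N \<sigma> r" using nbhd[OF v] by blast
  define T' where "T' = (if \<sigma> then (if r = k \<or> h < r then {v} else {node N True p |p. k < p \<and> p \<le> h})
    else (if r < h - 1 then {v} else {node N False q |q. h - 1 \<le> q \<and> q < N}))"
  have single: "win {v}" by (rule cop_wins.located) simp
  then have "win T'" unfolding T'_def using rest win_high by presburger
  moreover have "v' \<in> T'" if v': "v' \<in> closed_nbhd G T"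
    "replies G (probes True k) v' = replies G (probes True k) v" for v'
  proof -
    obtain \<sigma>' r' where r': "r' < N" "v' = node N \<sigma>' r'" using nbhd[OF v'(1)] by blast
    note sep = probes_separate[OF k r'(1) r(1), of True \<sigma>' \<sigma>]
      and sep' = probes_separate[OF k r(1) r'(1), of True \<sigma> \<sigma>']
    have eq: "replies G (probes True k) (node N \<sigma>' r') = replies G (probes True k) (node N \<sigma> r)"
      using v'(2) r(2) r'(2) by simp
    have \<sigma>: "\<sigma>' = \<sigma>" by (rule sep(1)[OF eq])
    show ?thesis
    proof (cases \<sigma>)
      case True
      have tests: "r' = k \<longleftrightarrow> r = k" "h < r' \<longrightarrow> r' = r" "h < r \<longrightarrow> r = r'"
        using sep(2)[OF eq] sep(4)[OF eq] sep'(4)[OF eq[symmetric]] \<sigma> True by blast+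
      show ?thesis
      proof (cases "r = k \<or> h < r")
        case r_known: True
        then have "r' = r" using tests by blast
        then show ?thesis using r_known r(2) r'(2) \<sigma> True by (simp add: T'_def)
      next
        case False
        have "\<not> r' < k" using low[of r'] v'(1) r'(2) \<sigma> True by auto
        moreover have "r' \<noteq> k" using tests(1) False by blast
        moreover have "r' \<le> h" using tests(2) False by linarith
        ultimately have "v' \<in> {node N True p |p. k < p \<and> p \<le> h}"
          using r'(2) \<sigma> True by (intro CollectI exI[of _ r']) simp
        then show ?thesis using False True by (simp add: T'_def)
      qed
    next
      case False
      then have min_eq: "min r' (h - 1) = min r (h - 1)" using sep(5)[OF eq] \<sigma> by blast
      show ?thesis
      proof (cases "r < h - 1")
        case r_low: True
        then have "r' = r" using min_eq by linarith
        then show ?thesis using r_low r(2) r'(2) \<sigma> False by (simp add: T'_def)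
      next
        case r_high: False
        then have "h - 1 \<le> r'" using min_eq by linarith
        then have "v' \<in> {node N False q |q. h - 1 \<le> q \<and> q < N}"
          using r'(1,2) \<sigma> False by (intro CollectI exI[of _ r']) simp
        then show ?thesis using r_high False by (simp add: T'_def)
      qed
    qed
  qed
  ultimately show "\<exists>T'. win T' \<and> (\<forall>v' \<in> closed_nbhd G T.
      replies G (probes True k) v' = replies G (probes True k) v \<longrightarrow> v' \<in> T')"
    by blast
qed

lemma win_side:
  assumes "k \<le> Suc h"
  shows "win {node N True p |p. k \<le> p \<and> p \<le> h}"
  using assms
proof (induction rule: inc_induct)
  case base
  show ?case by (rule cop_wins.located) auto
next
  case (step k)
  show ?case
  proof (rule win_sweep[of _ k])
    show "k \<le> h" using step(2) by simp
    have hN: "h < N" using h N_eq by simp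
    show verts: "{node N True p |p. k \<le> p \<and> p \<le> h} \<subseteq> pverts G"
      unfolding half_graph_verts subset_iff using hN by (auto intro: le_less_trans)
    show "node N True p \<notin> closed_nbhd G {node N True p |p. k \<le> p \<and> p \<le> h}" if "p < k" for p
    proof
      assume "node N True p \<in> closed_nbhd G {node N True p |p. k \<le> p \<and> p \<le> h}"
      from nbhd_node[OF this] verts obtain \<sigma> r where r: "r < N" "node N True p = node N \<sigma> r"
        "node N True p \<in> {node N True p |p. k \<le> p \<and> p \<le> h} \<or>
          (\<exists>r'. r + r' < N \<and> node N (\<not> \<sigma>) r' \<in> {node N True p |p. k \<le> p \<and> p \<le> h})"
        by blast
      have "p < N" using that step(2) hN by simp
      then have "\<sigma>" using r(1,2) node_eq_iff[of p N r True \<sigma>] by simp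
      then show False using r(3) \<open>p < k\<close> \<open>p < N\<close> step(2) hN by (auto simp: node_def)
    qed
    show "win {node N True p |p. k < p \<and> p \<le> h}" using step.IH by (simp add: Suc_le_eq)
  qed
qed

lemma k_locatable_G: "k_locatable h G"
proof (rule k_locatable_if_cop_wins[OF half_graph_wf])
  show "pverts G \<noteq> {}" using node_in_verts[of 0 N True] h N_eq by auto
  show "win (pverts G)"
  proof (rule win_sweep[of _ 0])
    show "win {node N True p |p. 0 < p \<and> p \<le> h}" using win_side[of 1] by (simp add: Suc_le_eq)
  qed simp_all
qed

end

section \<open>The two parameters of a half graph\<close>

lemma Inf_enat_eqI:
  assumes "a \<in> A" "\<And>x. x \<in> A \<Longrightarrow> a \<le> x"
  shows "Inf (enat ` A) = enat a"
proof (rule antisym)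
  show "Inf (enat ` A) \<le> enat a" using assms(1) by (intro Inf_lower) simp
  show "enat a \<le> Inf (enat ` A)" using assms(2) by (intro Inf_greatest) auto
qed

lemma rl_p_half_graph:
  assumes "0 < h"
  shows "rl_p (half_graph (2 * h)) = enat h"
  unfolding rl_p_def
proof (rule Inf_enat_eqI)
  interpret even_half_graph h "2 * h" using assms by unfold_locales simp_all
  show "h \<in> {k. k_locatable k (half_graph (2 * h))}" using k_locatable_G by simp
  show "h \<le> k" if "k \<in> {k. k_locatable k (half_graph (2 * h))}" for k
    using half_graph_not_k_locatable[of k h] that by (auto simp: not_less[symmetric])
qed

lemma rl_s_half_graph:
  assumes "3 \<le> m"
  shows "rl_s (half_graph (2 * 2 ^ (m - 1))) = enat m"
  unfolding rl_s_def
proof (rule Inf_enat_eqI)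
  let ?G = "half_graph (2 * 2 ^ (m - 1))"
  have "k_locatable 1 (edge_subdivision M ?G)" if "m \<le> M" for M
  proof -
    interpret long_subdivided_half_graph "2 * 2 ^ (m - 1)" M "2 ^ (m - 1)" "m - 1"
      using assms that by unfold_locales simp_all
    show ?thesis by (rule locatable_S)
  qed
  then show "m \<in> {s. 0 < s \<and> (\<forall>M \<ge> s. locatable (edge_subdivision M ?G))}" using assms by simp
  show "m \<le> s" if s: "s \<in> {s. 0 < s \<and> (\<forall>M \<ge> s. locatable (edge_subdivision M ?G))}" for s
  proof (rule ccontr)
    assume "\<not> m \<le> s"
    then have "locatable (edge_subdivision (m - 1) ?G)" using s by simp
    moreover interpret subdivided_half_graph "2 * 2 ^ (m - 1)" "m - 1"
      using assms by unfold_locales simp_all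
    have "\<not> locatable (edge_subdivision (m - 1) ?G)"
      using assms by (intro not_locatable_S[OF refl refl]) simp
    ultimately show False by blast
  qed
qed

theorem theorem8:
  fixes m :: nat
  assumes "m \<ge> 3"
  shows "\<exists>G :: nat pair_pre_digraph.
           pair_graph G \<and> connected (with_proj G) \<and> rl_s G = enat m \<and> rl_p G = enat (2 ^ (m - 1))"
proof (intro exI conjI)
  let ?G = "half_graph (2 * 2 ^ (m - 1))"
  show "pair_graph ?G" by (rule half_graph_pair_graph)
  show "connected (with_proj ?G)" by (rule half_graph_connected) simp
  show "rl_s ?G = enat m" using assms by (rule rl_s_half_graph)
  show "rl_p ?G = enat (2 ^ (m - 1))" by (rule rl_p_half_graph) simp
qed

end
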